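(* Let $k\in\{1,\dots,d\}$ and let $X_0,\dots,X_k$ be random vectors in $\mathbb{R}^d$ (not necessarily independent or identically distributed) whose joint distribution is spherically symmetric, i.e. for every orthogonal $d\times d$ matrix $U$ the tuple $(UX_0,\dots,UX_k)$ has the same distribution as $(X_0,\dots,X_k)$. Let $A$ be any non-singular real $d\times d$ matrix and let $\mathcal{E}:=\{\mathbf{x}\in\mathbb{R}^d:\ \mathbf{x}^\top(A^\top A)^{-1}\mathbf{x}\le 1\}$. Let $\xi$ be a random $k$-dimensional linear subspace of $\mathbb{R}^d$, uniformly distributed and independent of $(X_0,\dots,X_k)$, and let $P_\xi$ denote the orthogonal projection to $\xi$. Then $$|\operatorname{conv}(AX_0,\dots,AX_k)|\ \stackrel{d}{=}\ \frac{|P_\xi\mathcal{E}|}{\kappa_k}\cdot|\operatorname{conv}(X_0,\dots,X_k)|,$$ where $\stackrel{d}{=}$ denotes equality in distribution.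
   Context: $|\cdot|$ denotes $k$-dimensional volume, both of (possibly degenerate) convex hulls of $k+1$ points and of projections to $k$-dimensional linear subspaces. $\kappa_k=\pi^{k/2}/\Gamma(k/2+1)$ is the volume of the unit ball in $\mathbb{R}^k$. "Uniformly distributed" for a random $k$-dimensional linear subspace means distributed according to the unique rotation invariant probability measure $\nu_{d,k}$ on the Grassmannian $G_{d,k}$ of $k$-dimensional linear subspaces of $\mathbb{R}^d$. *)

theory Defs
  imports "HOL-Probability.Probability"
begin

section \<open>Volume in k-dimensional flats\<close>

definition orthonormal_frame :: "nat \<Rightarrow> (nat \<Rightarrow> 'a::euclidean_space) \<Rightarrow> bool" where
  "orthonormal_frame k b \<longleftrightarrow> (\<forall>i<k. \<forall>j<k. b i \<bullet> b j = (if i = j then 1 else 0))"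

definition frame_map :: "nat \<Rightarrow> 'a::euclidean_space \<Rightarrow> (nat \<Rightarrow> 'a) \<Rightarrow> (nat \<Rightarrow> real) \<Rightarrow> 'a" where
  "frame_map k p b t = p + (\<Sum>i<k. t i *\<^sub>R b i)"

text \<open>The Lebesgue measure of the coordinates of \<open>S\<close>, where \<open>\<real>\<^sup>k\<close> is realised as the
  product space \<open>{..<k} \<rightarrow>\<^sub>E UNIV\<close> so that \<open>k\<close> can be an ordinary variable.\<close>

definition frame_volume :: "nat \<Rightarrow> 'a::euclidean_space \<Rightarrow> (nat \<Rightarrow> 'a) \<Rightarrow> 'a set \<Rightarrow> real" where
  "frame_volume k p b S =
     measure (Pi\<^sub>M {..<k} (\<lambda>_. lborel)) {t \<in> {..<k} \<rightarrow>\<^sub>E UNIV. frame_map k p b t \<in> S}"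

text \<open>The k-dimensional volume of a set contained in some k-dimensional affine subspace. Two
  admissible choices of origin and frame differ by an isometry of \<open>\<real>\<^sup>k\<close>, or the set spans a flat
  of smaller dimension and has volume 0 in either; so the value does not depend on the choice.
  It is unspecified if \<open>S\<close> is not contained in any k-dimensional flat.\<close>

definition flat_volume :: "nat \<Rightarrow> 'a::euclidean_space set \<Rightarrow> real" where
  "flat_volume k S =
     (SOME v. \<exists>p b. orthonormal_frame k b \<and> S \<subseteq> range (frame_map k p b) \<and> v = frame_volume k p b S)"

section \<open>Random subspaces\<close>

definition orth_proj :: "'a::euclidean_space set \<Rightarrow> 'a \<Rightarrow> 'a" where
  "orth_proj L x = (THE y. y \<in> L \<and> (\<forall>z\<in>L. orthogonal (x - y) z))"

text \<open>The Grassmannian of k-dimensional linear subspaces with its Borel sigma-algebra: its usual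
  topology is the one that makes \<open>L \<mapsto> P\<^sub>L\<close> an embedding into the space of matrices.\<close>

definition grassmannian :: "nat \<Rightarrow> (real^'d) set measure" where
  "grassmannian k =
     vimage_algebra {L. subspace L \<and> dim L = k} (\<lambda>L. matrix (orth_proj L)) (borel :: (real^'d^'d) measure)"

text \<open>The rotation invariant probability measure on the Grassmannian, which is unique for
  \<open>k \<le> d\<close>.\<close>

definition rotation_invariant_prob :: "nat \<Rightarrow> (real^'d) set measure \<Rightarrow> bool" where
  "rotation_invariant_prob k \<nu> \<longleftrightarrow>
     prob_space \<nu> \<and> sets \<nu> = sets (grassmannian k) \<and>
     (\<forall>U :: real^'d^'d. orthogonal_matrix U \<longrightarrow>
        distr \<nu> (grassmannian k) (\<lambda>L. (*v) U ` L) = \<nu>)"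

definition uniform_random_subspace :: "'m measure \<Rightarrow> nat \<Rightarrow> ('m \<Rightarrow> (real^'d) set) \<Rightarrow> bool" where
  "uniform_random_subspace M k \<xi> \<longleftrightarrow>
     \<xi> \<in> M \<rightarrow>\<^sub>M grassmannian k \<and> rotation_invariant_prob k (distr M (grassmannian k) \<xi>)"

section \<open>Random tuples\<close>

definition tuple :: "nat \<Rightarrow> (nat \<Rightarrow> 'm \<Rightarrow> 'a) \<Rightarrow> 'm \<Rightarrow> (nat \<Rightarrow> 'a)" where
  "tuple k X \<omega> = (\<lambda>i\<in>{..k}. X i \<omega>)"

abbreviation tuple_space :: "nat \<Rightarrow> (nat \<Rightarrow> 'a::euclidean_space) measure" where
  "tuple_space k \<equiv> Pi\<^sub>M {..k} (\<lambda>_. borel)"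

definition spherically_symmetric :: "'m measure \<Rightarrow> nat \<Rightarrow> (nat \<Rightarrow> 'm \<Rightarrow> real^'d) \<Rightarrow> bool" where
  "spherically_symmetric M k X \<longleftrightarrow>
     (\<forall>U :: real^'d^'d. orthogonal_matrix U \<longrightarrow>
        distr M (tuple_space k) (tuple k (\<lambda>i \<omega>. U *v X i \<omega>)) = distr M (tuple_space k) (tuple k X))"

text \<open>Independence of \<open>f\<close> and \<open>g\<close> as independence of the sigma-algebras they generate;
  \<open>indep_var\<close> itself requires both variables to take values in the same type.\<close>

definition independent_rvs ::
    "'m measure \<Rightarrow> 'b measure \<Rightarrow> ('m \<Rightarrow> 'b) \<Rightarrow> 'c measure \<Rightarrow> ('m \<Rightarrow> 'c) \<Rightarrow> bool" where
  "independent_rvs M N f N' g \<longleftrightarrow>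
     f \<in> M \<rightarrow>\<^sub>M N \<and> g \<in> M \<rightarrow>\<^sub>M N' \<and>
     prob_space.indep_set M {f -` B \<inter> space M |B. B \<in> sets N} {g -` C \<inter> space M |C. C \<in> sets N'}"

text \<open>Measurability is part of the notion, since \<open>distr\<close> is meaningless without it.\<close>

definition eq_in_distribution :: "'m measure \<Rightarrow> ('m \<Rightarrow> real) \<Rightarrow> ('m \<Rightarrow> real) \<Rightarrow> bool" where
  "eq_in_distribution M Y Z \<longleftrightarrow>
     Y \<in> borel_measurable M \<and> Z \<in> borel_measurable M \<and> distr M borel Y = distr M borel Z"

end

theory Submission
  imports Defs
begin

text \<open>The matrix \<open>A\<close> maps a flat with direction \<open>L\<close> to a flat and multiplies \<open>k\<close>-dimensional volume by a factor
that depends on \<open>L\<close> only: the volume of the parallelepiped spanned by \<open>A b\<^sub>1, \<dots>, A b\<^sub>k\<close> for any orthonormal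
basis \<open>b\<close> of \<open>L\<close> (\<open>flat_volume_linear_image\<close>). The ellipsoid is the image of the unit ball under the transpose
of \<open>A\<close>, and its projection to \<open>L\<close> is the image of a \<open>k\<close>-dimensional unit ball under the adjoint of the
restriction \<open>L \<rightarrow> A L\<close> of \<open>A\<close>. A map and its adjoint have the same determinant, so the volume of the projection
divided by that of the ball is the same factor (\<open>flat_volume_projected_ellipsoid\<close>). Hence the
claim holds pointwise if \<open>\<xi>\<close> is replaced by the direction \<open>L(X)\<close> of the simplex; if the
simplex is degenerate, both volumes vanish, and any subspace will do.

It remains to compare the laws of \<open>(L(X), V)\<close> and \<open>(\<xi>, V)\<close>, where \<open>V\<close> is the volume of the simplex. For a
Borel set \<open>B\<close> of positive volumes, the law of \<open>L(X)\<close> on the event \<open>V \<in> B\<close> is a rotation invariant measure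
on the Grassmannian, because rotations preserve \<open>V\<close>. Such a measure is a multiple of the law of \<open>\<xi>\<close>, so
\<open>L(X)\<close> is uniformly distributed and independent of \<open>V\<close>, as \<open>\<xi>\<close> is (\<open>direction_law\<close>). Uniqueness of
the invariant measure is obtained without Haar measure: a measure that gives the same mass to all balls
of equal radius is determined up to a factor by integrating the kernel \<open>dist x y < r\<close> in two orders
(\<open>homogeneous_measures_le\<close>).

Two technical points shape the development. Since \<open>k\<close> is a variable, volume lives on functions \<open>nat \<Rightarrow> real\<close>
restricted to \<open>{..<k}\<close>; determinants of \<open>k \<times> k\<close> matrices are taken after padding with an identity
block. Since both laws are to be compared through Borel functions, the direction \<open>L(X)\<close> and the scaling
factor are written as explicit functions of the points and of the projection matrix.\<close>

section \<open>Linear change of variables in a space of variable dimension\<close>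

text \<open>An arbitrary enumeration of a finite index type, which lets a matrix of variable size \<open>k\<close> sit in the
first \<open>k\<close> coordinates of \<open>real^'n\<close>.\<close>

definition coord_index :: "'n::finite \<Rightarrow> nat" where
  "coord_index = (SOME f. bij_betw f UNIV {..<CARD('n)})"

definition coord_of :: "nat \<Rightarrow> 'n::finite" where
  "coord_of = the_inv_into UNIV coord_index"

lemma bij_coord_index: "bij_betw (coord_index :: 'n::finite \<Rightarrow> nat) UNIV {..<CARD('n)}"
proof -
  have "\<exists>f :: 'n \<Rightarrow> nat. bij_betw f UNIV {..<CARD('n)}"
    using ex_bij_betw_finite_nat[OF finite_class.finite_UNIV[where 'a='n]]
    by (simp add: atLeast0LessThan)
  then show ?thesis
    unfolding coord_index_def by (rule someI_ex)
qed

lemma coord_index_less [simp]: "coord_index (a::'n::finite) < CARD('n)"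
  using bij_coord_index[where 'n='n] by (auto simp: bij_betw_def)

lemma coord_of_index [simp]: "coord_of (coord_index a) = (a::'n::finite)"
  unfolding coord_of_def using bij_coord_index[where 'n='n]
  by (simp add: bij_betw_def the_inv_into_f_f)

lemma coord_index_of [simp]: "i < CARD('n) \<Longrightarrow> coord_index (coord_of i :: 'n::finite) = i"
  unfolding coord_of_def using bij_coord_index[where 'n='n]
  by (simp add: bij_betw_def f_the_inv_into_f)

lemma coord_index_inject [simp]: "coord_index a = coord_index b \<longleftrightarrow> a = (b::'n::finite)"
  by (metis coord_of_index)

lemma bij_coord_index_below:
  assumes "k \<le> CARD('n::finite)"
  shows "bij_betw coord_index {a::'n. coord_index a < k} {..<k}"
proof (rule bij_betw_byWitness[where f' = coord_of])
  show "coord_of ` {..<k} \<subseteq> {a::'n. coord_index a < k}"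
    using assms by auto
qed (use assms in auto)

lemma sum_coord_index_below:
  assumes "k \<le> CARD('n::finite)"
  shows "(\<Sum>a | coord_index (a::'n) < k. f (coord_index a)) = (\<Sum>i<k. f i)"
  by (rule sum.reindex_bij_betw[OF bij_coord_index_below[OF assms]])

lemma prod_coord_index_below:
  assumes "k \<le> CARD('n::finite)"
  shows "(\<Prod>a | coord_index (a::'n) < k. f (coord_index a)) = (\<Prod>i<k. f i)"
  by (rule prod.reindex_bij_betw[OF bij_coord_index_below[OF assms]])

text \<open>The block diagonal matrix of \<open>T\<close>, of size \<open>k\<close>, and an identity matrix.\<close>

definition pad :: "nat \<Rightarrow> (nat \<Rightarrow> nat \<Rightarrow> real) \<Rightarrow> real^'n^'n" where
  "pad k T = (\<chi> a b. if coord_index a < k \<and> coord_index b < k then T (coord_index a) (coord_index b)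
     else if a = b then 1 else 0)"

lemma transpose_pad: "transpose (pad k T) = pad k (\<lambda>i j. T j i)"
  by (auto simp: pad_def transpose_def vec_eq_iff)

lemma pad_mult_low:
  fixes y :: "real^'n"
  assumes "k \<le> CARD('n)" "coord_index a < k"
  shows "(pad k T *v y) $ a = (\<Sum>j<k. T (coord_index a) j * y $ coord_of j)"
proof -
  have "(pad k T *v y) $ a = (\<Sum>b\<in>UNIV. if coord_index b < k then T (coord_index a) (coord_index b) * y $ b else 0)"
    unfolding matrix_vector_mult_def pad_def using assms(2) by (auto intro!: sum.cong)
  also have "\<dots> = (\<Sum>b | coord_index (b::'n) < k. T (coord_index a) (coord_index b) * y $ coord_of (coord_index b))"
    by (simp add: sum.If_cases)
  also have "\<dots> = (\<Sum>j<k. T (coord_index a) j * y $ coord_of j)"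
    by (rule sum_coord_index_below[OF assms(1)])
  finally show ?thesis .
qed

lemma pad_mult_high:
  fixes y :: "real^'n"
  assumes "\<not> coord_index a < k"
  shows "(pad k T *v y) $ a = y $ a"
proof -
  have "(pad k T *v y) $ a = (\<Sum>b\<in>UNIV. if a = b then y $ b else 0)"
    using assms by (simp add: matrix_vector_mult_def pad_def if_distrib[where f = "\<lambda>x. x * _"] cong: if_cong)
  then show ?thesis by simp
qed

text \<open>Block diagonal matrices multiply blockwise; so \<open>det (pad k T)\<close> behaves like the determinant of \<open>T\<close>.\<close>

lemma pad_mult_pad:
  assumes "k \<le> CARD('n::finite)"
  shows "(pad k T :: real^'n^'n) ** pad k T' = pad k (\<lambda>i j. \<Sum>l<k. T i l * T' l j)"
proof -
  have "((pad k T :: real^'n^'n) *v (pad k T' *v y)) $ a = (pad k (\<lambda>i j. \<Sum>l<k. T i l * T' l j) *v y) $ a" for y a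
  proof (cases "coord_index a < k")
    case True
    have "((pad k T :: real^'n^'n) *v (pad k T' *v y)) $ a
       = (\<Sum>j<k. T (coord_index a) j * (\<Sum>i<k. T' j i * y $ coord_of i))"
      using assms by (simp add: pad_mult_low True)
    also have "\<dots> = (\<Sum>i<k. \<Sum>j<k. T (coord_index a) j * T' j i * y $ coord_of i)"
      by (subst sum.swap) (simp add: sum_distrib_left mult.assoc)
    finally show ?thesis
      using assms by (simp add: pad_mult_low True sum_distrib_right)
  qed (simp add: pad_mult_high)
  then show ?thesis
    by (simp add: matrix_eq matrix_vector_mul_assoc[symmetric] vec_eq_iff)
qed

lemma emeasure_lborel_cart_box:
  fixes B :: "'n::finite \<Rightarrow> real set"
  assumes [measurable]: "\<And>a. B a \<in> sets borel"
  shows "emeasure lborel {y::real^'n. \<forall>a. y $ a \<in> B a} = (\<Prod>a\<in>UNIV. emeasure lborel (B a))"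
proof -
  interpret product_sigma_finite "\<lambda>_::real^'n. lborel :: real measure" by standard
  define C :: "real^'n \<Rightarrow> real set" where "C e = B (THE a. e = axis a 1)" for e
  have C: "C (axis a 1) = B a" for a by (simp add: C_def axis_eq_axis)
  have basis: "(Basis :: (real^'n) set) = (\<lambda>a. axis a 1) ` UNIV"
    by (auto simp: Basis_vec_def)
  have inj: "inj (\<lambda>a::'n. axis a (1::real))" by (auto simp: inj_on_def axis_eq_axis)
  have "emeasure lborel {y::real^'n. \<forall>a. y $ a \<in> B a}
     = emeasure (\<Pi>\<^sub>M b\<in>Basis. lborel) ((\<lambda>f. \<Sum>b\<in>Basis. f b *\<^sub>R b) -` {y::real^'n. \<forall>a. y $ a \<in> B a}
          \<inter> space (\<Pi>\<^sub>M b\<in>(Basis::(real^'n) set). lborel))"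
    by (subst lborel_eq, rule emeasure_distr) measurable
  also have "(\<lambda>f. \<Sum>b\<in>Basis. f b *\<^sub>R b) -` {y::real^'n. \<forall>a. y $ a \<in> B a}
          \<inter> space (\<Pi>\<^sub>M b\<in>(Basis::(real^'n) set). lborel) = Pi\<^sub>E Basis C"
  proof -
    have "(\<Sum>b\<in>Basis. f b *\<^sub>R b) $ a = f (axis a 1)" for f and a :: 'n
    proof -
      have "(\<Sum>b\<in>Basis. f b *\<^sub>R b) $ a = (\<Sum>c\<in>UNIV. f (axis c 1) * axis c 1 $ a)"
        by (simp add: basis sum.reindex[OF inj])
      also have "\<dots> = (\<Sum>c\<in>UNIV. if c = a then f (axis c 1) else 0)"
        by (intro sum.cong) (auto simp: axis_def)
      finally show ?thesis by simp
    qed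
    then show ?thesis
      by (auto simp: space_PiM PiE_iff C basis)
  qed
  also have "emeasure (\<Pi>\<^sub>M b\<in>Basis. lborel) (Pi\<^sub>E Basis C) = (\<Prod>b\<in>Basis. emeasure lborel (C b))"
    by (rule emeasure_PiM) (auto simp: C basis)
  also have "\<dots> = (\<Prod>a\<in>UNIV. emeasure lborel (B a))"
    by (simp add: basis prod.reindex[OF inj] C)
  finally show ?thesis .
qed

text \<open>The product of \<open>S\<close> with a unit cube in the remaining coordinates. It has the measure of \<open>S\<close>.\<close>

definition thicken :: "nat \<Rightarrow> (nat \<Rightarrow> real) set \<Rightarrow> (real^'n) set" where
  "thicken k S = {y. (\<lambda>i\<in>{..<k}. y $ coord_of i) \<in> S \<and> (\<forall>a. k \<le> coord_index a \<longrightarrow> y $ a \<in> {0..1})}"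

lemma thicken_sets:
  assumes [measurable]: "S \<in> sets (Pi\<^sub>M {..<k} (\<lambda>_. lborel))"
  shows "(thicken k S :: (real^'n) set) \<in> sets borel"
proof -
  have [measurable]: "(\<lambda>y::real^'n. \<lambda>i\<in>{..<k}. y $ coord_of i) \<in> borel \<rightarrow>\<^sub>M Pi\<^sub>M {..<k} (\<lambda>_. lborel)"
    by (rule measurable_restrict) simp
  show ?thesis unfolding thicken_def by measurable
qed

text \<open>Integrating out the unit cube leaves a measure on \<open>{..<k} \<rightarrow>\<^sub>E UNIV\<close> that agrees with the product measure on
rectangles, and the product measure is determined by rectangles.\<close>

lemma emeasure_thicken:
  assumes k: "k \<le> CARD('n::finite)" and S: "S \<in> sets (Pi\<^sub>M {..<k} (\<lambda>_. lborel))"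
  shows "emeasure lborel (thicken k S :: (real^'n) set) = emeasure (Pi\<^sub>M {..<k} (\<lambda>_. lborel)) S"
proof -
  interpret product_sigma_finite "\<lambda>_::nat. lborel :: real measure" by standard
  let ?P = "Pi\<^sub>M {..<k} (\<lambda>_. lborel) :: (nat \<Rightarrow> real) measure"
  let ?Q = "{y::real^'n. \<forall>a. k \<le> coord_index a \<longrightarrow> y $ a \<in> {0..1}}"
  let ?r = "\<lambda>y::real^'n. \<lambda>i\<in>{..<k}. y $ coord_of i"
  \<comment> \<open>Lebesgue measure on \<open>?Q\<close>, projected to the first \<open>k\<close> coordinates.\<close>
  define N where "N = distr (density lborel (indicator ?Q)) ?P ?r"
  have [measurable]: "?r \<in> borel \<rightarrow>\<^sub>M ?P"
    by (rule measurable_restrict) simp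
  have [measurable]: "?Q \<in> sets borel" by measurable
  have N: "emeasure N R = emeasure lborel (thicken k R :: (real^'n) set)" if [measurable]: "R \<in> sets ?P" for R
  proof -
    have "emeasure N R = emeasure (density lborel (indicator ?Q)) (?r -` R)"
      unfolding N_def by (subst emeasure_distr) auto
    also have "\<dots> = emeasure lborel (?Q \<inter> ?r -` R)"
      by (rule emeasure_restricted) (use measurable_sets[of ?r borel ?P R] in auto)
    also have "?Q \<inter> ?r -` R = thicken k R" by (auto simp: thicken_def)
    finally show ?thesis .
  qed
  have "N = ?P"
  proof (rule PiM_eqI)
    fix A :: "nat \<Rightarrow> real set"
    assume A: "\<And>i. i \<in> {..<k} \<Longrightarrow> A i \<in> sets lborel"
    define B :: "'n \<Rightarrow> real set" where "B a = (if coord_index a < k then A (coord_index a) else {0..1})" for a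
    have "thicken k (Pi\<^sub>E {..<k} A) = {y::real^'n. \<forall>a. y $ a \<in> B a}"
    proof (rule set_eqI)
      fix y :: "real^'n"
      have "(\<forall>i<k. y $ coord_of i \<in> A i) \<longleftrightarrow> (\<forall>a. coord_index a < k \<longrightarrow> y $ a \<in> A (coord_index a))"
        using k by (metis coord_index_of coord_of_index order_less_le_trans)
      then show "y \<in> thicken k (Pi\<^sub>E {..<k} A) \<longleftrightarrow> y \<in> {y. \<forall>a. y $ a \<in> B a}"
        by (auto simp: thicken_def B_def PiE_iff not_less)
    qed
    moreover have "Pi\<^sub>E {..<k} A \<in> sets ?P"
      using A by (intro sets_PiM_I_finite) auto
    moreover have "B a \<in> sets borel" for a
      using A by (simp add: B_def)
    ultimately have "emeasure N (Pi\<^sub>E {..<k} A) = (\<Prod>a\<in>(UNIV::'n set). emeasure lborel (B a))"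
      by (simp add: N emeasure_lborel_cart_box)
    also have "\<dots> = (\<Prod>a\<in>(UNIV::'n set). if coord_index a < k then emeasure lborel (A (coord_index a)) else 1)"
      by (auto intro!: prod.cong simp: B_def)
    also have "\<dots> = (\<Prod>a | coord_index (a::'n) < k. emeasure lborel (A (coord_index a)))"
      by (simp add: prod.If_cases)
    also have "\<dots> = (\<Prod>i<k. emeasure lborel (A i))"
      by (rule prod_coord_index_below[OF k])
    finally show "emeasure N (Pi\<^sub>E {..<k} A) = (\<Prod>i\<in>{..<k}. emeasure lborel (A i))" .
  qed (auto simp: N_def)
  then show ?thesis using N[OF S] by simp
qed

text \<open>The padded matrix leaves the coordinates of the unit cube alone, so the thickening of an affine image
is the affine image of the thickening. This transfers the change of variables formula from a
space whose dimension is a type to dimension \<open>k\<close>.\<close>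

lemma measure_affine_image:
  fixes T :: "nat \<Rightarrow> nat \<Rightarrow> real" and c :: "nat \<Rightarrow> real"
  assumes k: "k \<le> CARD('n::{finite,wellorder})"
    and S: "S \<in> sets (Pi\<^sub>M {..<k} (\<lambda>_. lborel))" "emeasure (Pi\<^sub>M {..<k} (\<lambda>_. lborel)) S < \<infinity>" and S': "S' \<in> sets (Pi\<^sub>M {..<k} (\<lambda>_. lborel))"
    and image: "S' = (\<lambda>t. \<lambda>i\<in>{..<k}. c i + (\<Sum>j<k. T i j * t j)) ` S"
  shows "measure (Pi\<^sub>M {..<k} (\<lambda>_. lborel)) S' = \<bar>det (pad k T :: real^'n::_^'n::_)\<bar> * measure (Pi\<^sub>M {..<k} (\<lambda>_. lborel)) S"
proof -
  define v :: "real^'n::_" where "v = (\<chi> a. if coord_index a < k then c (coord_index a) else 0)"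
  let ?f = "\<lambda>y::real^'n::_. pad k T *v y"
  have t_ext: "t \<in> extensional {..<k}" if "t \<in> S" for t
    using subsetD[OF sets.sets_into_space[OF S(1)] that] by (simp add: space_PiM PiE_iff)
  have f_low: "(v + ?f y) $ coord_of i = c i + (\<Sum>j<k. T i j * y $ coord_of j)" if "i < k" for i y
    using that k by (simp add: v_def pad_mult_low)
  have f_high: "(v + ?f y) $ a = y $ a" if "k \<le> coord_index a" for a y
    using that by (simp add: v_def pad_mult_high)
  have "(+) v ` ?f ` thicken k S = (thicken k S' :: (real^'n::_) set)"
  proof (intro set_eqI iffI)
    fix z assume "z \<in> (+) v ` ?f ` thicken k S"
    then obtain y where y: "y \<in> thicken k S" and z: "z = v + ?f y" by auto
    have "(\<lambda>i\<in>{..<k}. z $ coord_of i) = (\<lambda>i\<in>{..<k}. c i + (\<Sum>j<k. T i j * (\<lambda>i\<in>{..<k}. y $ coord_of i) j))"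
      unfolding z by (intro restrict_ext) (simp add: f_low del: vector_add_component)
    moreover have "(\<lambda>i\<in>{..<k}. y $ coord_of i) \<in> S" using y by (simp add: thicken_def)
    ultimately have "(\<lambda>i\<in>{..<k}. z $ coord_of i) \<in> S'"
      unfolding image by (rule image_eqI)
    moreover have "z $ a \<in> {0..1}" if "k \<le> coord_index a" for a
      using y f_high[OF that, of y] that unfolding z thicken_def by simp
    ultimately show "z \<in> thicken k S'"
      by (simp add: thicken_def)
  next
    fix z :: "real^'n::_" assume z: "z \<in> thicken k S'"
    then obtain t where t: "t \<in> S" "(\<lambda>i\<in>{..<k}. z $ coord_of i) = (\<lambda>i\<in>{..<k}. c i + (\<Sum>j<k. T i j * t j))"
      unfolding thicken_def image by auto
    define y :: "real^'n::_" where "y = (\<chi> a. if coord_index a < k then t (coord_index a) else z $ a)"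
    have yt: "(\<lambda>i\<in>{..<k}. y $ coord_of i) = t"
      using t_ext[OF t(1)] k unfolding y_def extensional_def by (intro ext) simp
    have "y $ a \<in> {0..1}" if "k \<le> coord_index a" for a
      using z that unfolding y_def thicken_def by simp
    with yt t(1) have "y \<in> thicken k S"
      by (simp add: thicken_def)
    moreover have "z = v + ?f y"
    proof (subst vec_eq_iff, intro allI)
      fix a show "z $ a = (v + ?f y) $ a"
      proof (cases "coord_index a < k")
        case True
        have "z $ a = (\<lambda>i\<in>{..<k}. z $ coord_of i) (coord_index a)" using True by simp
        also have "\<dots> = c (coord_index a) + (\<Sum>j<k. T (coord_index a) j * t j)"
          unfolding t using True by simp
        also have "\<dots> = (v + ?f y) $ coord_of (coord_index a)"
          unfolding f_low[OF True] yt[symmetric] by simp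
        finally show ?thesis by simp
      next
        case False
        then show ?thesis by (simp add: v_def pad_mult_high y_def)
      qed
    qed
    ultimately show "z \<in> (+) v ` ?f ` thicken k S" by auto
  qed
  moreover have fm: "(thicken k S :: (real^'n::_) set) \<in> lmeasurable"
    using S thicken_sets[where 'n='n and S=S and k=k] emeasure_thicken[OF k, of S]
    unfolding fmeasurable_def by (simp add: emeasure_completion)
  ultimately have "measure lebesgue (thicken k S' :: (real^'n::_) set)
      = \<bar>det (pad k T :: real^'n::_^'n::_)\<bar> * measure lebesgue (thicken k S :: (real^'n::_) set)"
    using measure_linear_image[of ?f "thicken k S", OF matrix_vector_mul_linear fm]
      measure_translation[of v "?f ` thicken k S"]
    by (metis matrix_of_matrix_vector_mul)
  moreover have "measure lebesgue (thicken k R :: (real^'n::_) set) = measure (Pi\<^sub>M {..<k} (\<lambda>_. lborel)) R" if "R \<in> sets (Pi\<^sub>M {..<k} (\<lambda>_. lborel))" for R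
    using emeasure_thicken[OF k, of R] thicken_sets[where 'n='n and S=R and k=k] that
    unfolding measure_def by (simp add: emeasure_completion)
  ultimately show ?thesis
    using S S' by simp
qed

section \<open>Orthonormal frames and the volume of flat sets\<close>

lemma inner_frame_sum:
  assumes "orthonormal_frame k b" "i < k"
  shows "(\<Sum>j<k. t j *\<^sub>R b j) \<bullet> b i = t i"
proof -
  have "(\<Sum>j<k. t j *\<^sub>R b j) \<bullet> b i = (\<Sum>j<k. if j = i then t j else 0)"
    unfolding inner_sum_left using assms
    by (intro sum.cong) (auto simp: orthonormal_frame_def)
  also have "\<dots> = t i" using assms(2) by simp
  finally show ?thesis .
qed

lemma inner_frame_map:
  assumes "orthonormal_frame k b" "i < k"
  shows "(frame_map k p b t - p) \<bullet> b i = t i"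
  using inner_frame_sum[OF assms] by (simp add: frame_map_def)

lemma frame_map_inner:
  assumes "orthonormal_frame k b" "x \<in> range (frame_map k p b)"
  shows "frame_map k p b (\<lambda>i\<in>{..<k}. (x - p) \<bullet> b i) = x"
proof -
  obtain t where x: "x = frame_map k p b t" using assms(2) by auto
  have "frame_map k p b (\<lambda>i\<in>{..<k}. (x - p) \<bullet> b i) = frame_map k p b t"
    unfolding x using inner_frame_map[OF assms(1)] by (simp add: frame_map_def)
  then show ?thesis by (simp add: x)
qed

lemma in_span_frame:
  assumes "orthonormal_frame k b" "x \<in> span (b ` {..<k})"
  shows "(\<Sum>i<k. (x \<bullet> b i) *\<^sub>R b i) = x"
  using assms(2)
proof (induction x rule: span_induct_alt)
  case base
  then show ?case by simp
next
  case (step c y z)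
  then obtain j where j: "j < k" "y = b j" by auto
  have "(\<Sum>i<k. (y \<bullet> b i) *\<^sub>R b i) = (\<Sum>i<k. if i = j then y else 0)"
    using assms(1) j by (intro sum.cong) (auto simp: orthonormal_frame_def)
  also have "\<dots> = y" using j by simp
  finally have y: "(\<Sum>i<k. (y \<bullet> b i) *\<^sub>R b i) = y" .
  have "(\<Sum>i<k. ((c *\<^sub>R y + z) \<bullet> b i) *\<^sub>R b i)
      = c *\<^sub>R (\<Sum>i<k. (y \<bullet> b i) *\<^sub>R b i) + (\<Sum>i<k. (z \<bullet> b i) *\<^sub>R b i)"
    by (simp add: inner_add_left scaleR_add_left sum.distrib scaleR_sum_right)
  then show ?case by (simp add: y step)
qed

lemma range_frame_map:
  assumes "orthonormal_frame k b"
  shows "x \<in> range (frame_map k p b) \<longleftrightarrow> x - p \<in> span (b ` {..<k})"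
proof
  assume "x \<in> range (frame_map k p b)"
  then obtain t where "x - p = (\<Sum>i<k. t i *\<^sub>R b i)" by (auto simp: frame_map_def)
  also have "\<dots> \<in> span (b ` {..<k})"
    by (intro span_sum span_scale) (auto intro: span_base)
  finally show "x - p \<in> span (b ` {..<k})" .
next
  assume "x - p \<in> span (b ` {..<k})"
  from in_span_frame[OF assms this]
  have "x = frame_map k p b (\<lambda>i. (x - p) \<bullet> b i)"
    by (simp add: frame_map_def algebra_simps)
  then show "x \<in> range (frame_map k p b)" by blast
qed

definition frame_coords :: "nat \<Rightarrow> 'a::euclidean_space \<Rightarrow> (nat \<Rightarrow> 'a) \<Rightarrow> 'a set \<Rightarrow> (nat \<Rightarrow> real) set" where
  "frame_coords k p b S = {t \<in> {..<k} \<rightarrow>\<^sub>E UNIV. frame_map k p b t \<in> S}"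

lemma frame_volume_coords:
  "frame_volume k p b S = measure (Pi\<^sub>M {..<k} (\<lambda>_. lborel)) (frame_coords k p b S)"
  by (simp add: frame_volume_def frame_coords_def)

lemma sets_frame_coords:
  assumes [measurable]: "S \<in> sets borel"
  shows "frame_coords k p b S \<in> sets (Pi\<^sub>M {..<k} (\<lambda>_. lborel))"
proof -
  have [measurable]: "frame_map k p b \<in> Pi\<^sub>M {..<k} (\<lambda>_. lborel) \<rightarrow>\<^sub>M borel"
    unfolding frame_map_def by measurable
  have "frame_coords k p b S = frame_map k p b -` S \<inter> space (Pi\<^sub>M {..<k} (\<lambda>_. lborel))"
    by (auto simp: frame_coords_def space_PiM)
  then show ?thesis by simp
qed

lemma emeasure_frame_coords_finite:
  assumes "orthonormal_frame k b" "bounded S"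
  shows "emeasure (Pi\<^sub>M {..<k} (\<lambda>_. lborel)) (frame_coords k p b S) < \<infinity>"
proof -
  interpret product_sigma_finite "\<lambda>_::nat. lborel :: real measure" by standard
  obtain C where C: "\<And>x. x \<in> S \<Longrightarrow> norm (x - p) \<le> C"
    using assms(2) unfolding bounded_any_center[where a = p]
    by (auto simp: dist_norm norm_minus_commute)
  have "frame_coords k p b S \<subseteq> Pi\<^sub>E {..<k} (\<lambda>_. {-C..C})"
  proof
    fix t assume t: "t \<in> frame_coords k p b S"
    have "t i \<in> {-C..C}" if "i < k" for i
    proof -
      have "\<bar>t i\<bar> = \<bar>(frame_map k p b t - p) \<bullet> b i\<bar>"
        using inner_frame_map[OF assms(1) that] by simp
      also have "\<dots> \<le> norm (frame_map k p b t - p) * norm (b i)"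
        by (rule Cauchy_Schwarz_ineq2)
      also have "norm (b i) = 1"
        using assms(1) that by (simp add: orthonormal_frame_def norm_eq_sqrt_inner)
      finally show ?thesis
        using C[of "frame_map k p b t"] t by (simp add: frame_coords_def abs_le_iff)
    qed
    then show "t \<in> Pi\<^sub>E {..<k} (\<lambda>_. {-C..C})"
      using t by (simp add: frame_coords_def PiE_iff)
  qed
  then have "emeasure (Pi\<^sub>M {..<k} (\<lambda>_. lborel)) (frame_coords k p b S)
      \<le> emeasure (Pi\<^sub>M {..<k} (\<lambda>_. lborel)) (Pi\<^sub>E {..<k} (\<lambda>_. {-C..C}))"
    by (intro emeasure_mono sets_PiM_I_finite) auto
  also have "\<dots> = (\<Prod>i<k. emeasure lborel {-C..C})"
    by (intro emeasure_PiM) auto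
  also have "\<dots> = emeasure lborel {-C..C} ^ k" by simp
  also have "\<dots> < \<infinity>"
    by (simp add: power_less_top_ennreal emeasure_lborel_Icc_eq)
  finally show ?thesis .
qed

lemma compact_linear_image:
  fixes F :: "'a::euclidean_space \<Rightarrow> 'b::euclidean_space"
  assumes "linear F" "compact S"
  shows "compact (F ` S)"
  using assms by (intro compact_continuous_image linear_continuous_on)
    (simp_all flip: linear_conv_bounded_linear)

text \<open>In coordinates with respect to the two frames, \<open>F\<close> is an affine map with the matrix of inner products
\<open>F (b j) \<bullet> b' i\<close>. The target flat is only assumed to contain \<open>F ` S\<close>; it need not contain the image of the whole
source flat, and for \<open>F = id\<close> this compares two flats that share the set \<open>S\<close>.\<close>

lemma frame_volume_linear_image:
  fixes F :: "'a::euclidean_space \<Rightarrow> 'b::euclidean_space"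
  assumes k: "k \<le> CARD('n::{finite,wellorder})"
    and b: "orthonormal_frame k b" and b': "orthonormal_frame k b'"
    and F: "linear F" and S: "compact S"
    and sub: "S \<subseteq> range (frame_map k p b)" and sub': "F ` S \<subseteq> range (frame_map k p' b')"
  shows "frame_volume k p' b' (F ` S)
    = \<bar>det (pad k (\<lambda>i j. F (b j) \<bullet> b' i) :: real^'n::_^'n::_)\<bar> * frame_volume k p b S"
proof -
  let ?g = "\<lambda>t. \<lambda>i\<in>{..<k}. (F p - p') \<bullet> b' i + (\<Sum>j<k. F (b j) \<bullet> b' i * t j)"
  have F_map: "(\<lambda>i\<in>{..<k}. (F (frame_map k p b t) - p') \<bullet> b' i) = ?g t" for t
    by (intro restrict_ext)
      (simp add: frame_map_def linear_add[OF F] linear_sum[OF F] linear_scale[OF F]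
        inner_add_left inner_diff_left inner_sum_left mult.commute)
  have "compact (F ` S)"
    by (rule compact_linear_image[OF F S])
  then have meas: "S \<in> sets borel" "F ` S \<in> sets borel"
    using S by (auto intro: borel_compact)
  have "frame_coords k p' b' (F ` S) = ?g ` frame_coords k p b S"
  proof (intro set_eqI iffI)
    fix t' assume t': "t' \<in> frame_coords k p' b' (F ` S)"
    then obtain x where x: "x \<in> S" "frame_map k p' b' t' = F x"
      by (auto simp: frame_coords_def)
    define t where "t = (\<lambda>i\<in>{..<k}. (x - p) \<bullet> b i)"
    have xt: "frame_map k p b t = x"
      unfolding t_def using frame_map_inner[OF b] sub x(1) by auto
    have "t' = (\<lambda>i\<in>{..<k}. t' i)"
      using t' by (simp add: frame_coords_def PiE_iff extensional_restrict)
    also have "\<dots> = (\<lambda>i\<in>{..<k}. (frame_map k p' b' t' - p') \<bullet> b' i)"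
      by (intro restrict_ext) (simp add: inner_frame_map[OF b'])
    also have "\<dots> = ?g t"
      unfolding x(2) xt[symmetric] F_map ..
    finally have "t' = ?g t" .
    moreover have "t \<in> frame_coords k p b S"
      using x(1) xt unfolding frame_coords_def t_def by auto
    ultimately show "t' \<in> ?g ` frame_coords k p b S"
      by (rule image_eqI)
  next
    fix t' assume "t' \<in> ?g ` frame_coords k p b S"
    then obtain t where t: "frame_map k p b t \<in> S" "t' = ?g t"
      by (auto simp: frame_coords_def)
    have "frame_map k p' b' t' = F (frame_map k p b t)"
      unfolding t(2) F_map[symmetric] using frame_map_inner[OF b'] sub' t(1) by auto
    then show "t' \<in> frame_coords k p' b' (F ` S)"
      using t by (simp add: frame_coords_def)
  qed
  then show ?thesis
    unfolding frame_volume_coords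
    by (intro measure_affine_image[OF k] sets_frame_coords meas
        emeasure_frame_coords_finite[OF b] compact_imp_bounded[OF S])
qed

text \<open>The identity expresses either volume as \<open>\<bar>det T\<bar>\<close> times the other, with transposed matrices and hence the same
factor \<open>c\<close> in both directions. So each volume is \<open>c\<^sup>2\<close> times itself: it is \<open>0\<close>, or \<open>c = 1\<close>. The first
alternative covers a set \<open>S\<close> in the lower-dimensional intersection of two different flats.

The index type \<open>'d bit0\<close> has \<open>2 * CARD('d) \<ge> k\<close> elements and, unlike a general finite type \<open>'d\<close>, comes with
the well-order that \<open>measure_linear_image\<close> asks of the index type.\<close>

lemma frame_volume_unique:
  fixes S :: "(real^'d) set"
  assumes k: "k \<le> CARD('d)"
    and b: "orthonormal_frame k b" "S \<subseteq> range (frame_map k p b)"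
    and b': "orthonormal_frame k b'" "S \<subseteq> range (frame_map k p' b')"
    and S: "compact S"
  shows "frame_volume k p' b' S = frame_volume k p b S"
proof -
  have k': "k \<le> CARD('d bit0)" using k by simp
  let ?T = "pad k (\<lambda>i j. b j \<bullet> b' i) :: real^('d bit0)^('d bit0)"
  let ?T' = "pad k (\<lambda>i j. b' j \<bullet> b i) :: real^('d bit0)^('d bit0)"
  have v': "frame_volume k p' b' S = \<bar>det ?T\<bar> * frame_volume k p b S"
    using frame_volume_linear_image[OF k' b(1) b'(1) linear_id S b(2), of p'] b'(2) by simp
  have v: "frame_volume k p b S = \<bar>det ?T'\<bar> * frame_volume k p' b' S"
    using frame_volume_linear_image[OF k' b'(1) b(1) linear_id S b'(2), of p] b(2) by simp
  have "?T' = transpose ?T"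
    by (simp add: transpose_pad inner_commute)
  then have "\<bar>det ?T'\<bar> = \<bar>det ?T\<bar>" by (simp add: det_transpose)
  with v v' have "frame_volume k p' b' S = \<bar>det ?T\<bar>\<^sup>2 * frame_volume k p' b' S"
    by (simp add: power2_eq_square)
  then have "frame_volume k p' b' S = 0 \<or> \<bar>det ?T\<bar>\<^sup>2 = 1"
    by (simp only: mult_cancel_right1)
  then have "frame_volume k p' b' S = 0 \<or> \<bar>det ?T\<bar> = 1"
    by (metis abs_abs abs_1 real_sqrt_abs real_sqrt_one)
  then show ?thesis
  proof
    assume "frame_volume k p' b' S = 0"
    then show ?thesis using v by simp
  next
    assume "\<bar>det ?T\<bar> = 1"
    then show ?thesis using v' by simp
  qed
qed

lemma flat_volume_eq_frame_volume:
  fixes S :: "(real^'d) set"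
  assumes "k \<le> CARD('d)" "orthonormal_frame k b" "S \<subseteq> range (frame_map k p b)" "compact S"
  shows "flat_volume k S = frame_volume k p b S"
  unfolding flat_volume_def
  by (rule some_equality) (use assms frame_volume_unique[OF assms(1)] in blast)+

lemma orthonormal_frame_extend:
  fixes b :: "nat \<Rightarrow> 'a::euclidean_space"
  assumes b: "orthonormal_frame m b" and n: "m \<le> n" "n \<le> DIM('a)"
  obtains b' where "orthonormal_frame n b'" "\<And>i. i < m \<Longrightarrow> b' i = b i"
proof -
  have "\<exists>b'. orthonormal_frame n b' \<and> (\<forall>i<m. b' i = b i)"
    using n
  proof (induction n rule: dec_induct)
    case base
    then show ?case using b by auto
  next
    case (step n)
    then obtain b' where b': "orthonormal_frame n b'" "\<forall>i<m. b' i = b i" by auto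
    have "dim (b' ` {..<n}) \<le> card (b' ` {..<n})" by (rule dim_le_card') simp
    also have "\<dots> \<le> n" using card_image_le[of "{..<n}" b'] by simp
    also have "n < DIM('a)" using step by simp
    finally obtain x where x: "x \<noteq> 0" "\<And>y. y \<in> span (b' ` {..<n}) \<Longrightarrow> orthogonal x y"
      by (rule orthogonal_to_subspace_exists) blast
    define b'' where "b'' = b'(n := sgn x)"
    have "sgn x \<bullet> b' i = 0" if "i < n" for i
      using x(2)[of "b' i"] that by (auto simp: span_base orthogonal_def sgn_div_norm)
    moreover have "sgn x \<bullet> sgn x = 1"
      using x(1) by (simp add: norm_sgn flip: power2_norm_eq_inner)
    ultimately have "orthonormal_frame (Suc n) b''"
      using b'(1) by (auto simp: orthonormal_frame_def b''_def less_Suc_eq inner_commute)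
    moreover have "\<forall>i<m. b'' i = b i"
      using b'(2) step by (auto simp: b''_def)
    ultimately show ?case by blast
  qed
  then show ?thesis using that by blast
qed

lemma subspace_frame:
  fixes L :: "'a::euclidean_space set"
  assumes "subspace L"
  obtains b where "orthonormal_frame (dim L) b" "span (b ` {..<dim L}) = L"
proof -
  obtain B where B: "B \<subseteq> L" "pairwise orthogonal B" "\<And>x. x \<in> B \<Longrightarrow> norm x = 1"
    "independent B" "card B = dim L" "span B = L"
    using orthonormal_basis_subspace[OF assms] by blast
  obtain b where b: "bij_betw b {..<dim L} B"
    using ex_bij_betw_nat_finite[OF independent_imp_finite[OF B(4)]] B(5)
    by (auto simp: atLeast0LessThan)
  have "b i \<bullet> b j = (if i = j then 1 else 0)" if "i < dim L" "j < dim L" for i j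
  proof (cases "i = j")
    case True
    then show ?thesis using bij_betwE[OF b] B(3) that by (auto simp flip: power2_norm_eq_inner)
  next
    case False
    then have "b i \<noteq> b j" using b that by (auto simp: bij_betw_def inj_on_def)
    then show ?thesis
      using False B(2) bij_betwE[OF b] that by (auto simp: pairwise_def orthogonal_def)
  qed
  then have "orthonormal_frame (dim L) b"
    by (simp add: orthonormal_frame_def)
  moreover have "span (b ` {..<dim L}) = L"
    using b B(6) by (simp add: bij_betw_def)
  ultimately show ?thesis by (rule that)
qed

text \<open>A frame of \<open>k\<close> vectors that starts with a basis of \<open>L\<close>. For \<open>dim L < k\<close> it provides a \<open>k\<close>-flat around a
degenerate simplex; for \<open>k = DIM('a)\<close> it completes a basis of \<open>L\<close> to a basis of the whole space.\<close>

lemma frame_around: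
  fixes L :: "'a::euclidean_space set"
  assumes "subspace L" "dim L \<le> k" "k \<le> DIM('a)"
  obtains b where "orthonormal_frame k b" "span (b ` {..<dim L}) = L"
proof -
  obtain b where b: "orthonormal_frame (dim L) b" "span (b ` {..<dim L}) = L"
    using subspace_frame[OF assms(1)] .
  obtain b' where b': "orthonormal_frame k b'" "\<And>i. i < dim L \<Longrightarrow> b' i = b i"
    using orthonormal_frame_extend[OF b(1) assms(2,3)] by blast
  have "b' ` {..<dim L} = b ` {..<dim L}" using b'(2) by auto
  then show ?thesis using that[OF b'(1)] b(2) by simp
qed

lemma independent_frame:
  assumes "orthonormal_frame k b"
  shows "independent (b ` {..<k})" "inj_on b {..<k}" "dim (span (b ` {..<k})) = k"
proof -
  show inj: "inj_on b {..<k}"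
  proof (rule inj_onI)
    fix i j assume ij: "i \<in> {..<k}" "j \<in> {..<k}" "b i = b j"
    then have "b i \<bullet> b j = 1" using assms unfolding orthonormal_frame_def by fastforce
    then show "i = j" using assms ij unfolding orthonormal_frame_def by (metis lessThan_iff zero_neq_one)
  qed
  have "pairwise orthogonal (b ` {..<k})"
    using assms by (auto simp: pairwise_def orthogonal_def orthonormal_frame_def)
  moreover have "0 \<notin> b ` {..<k}"
    using assms by (force simp: orthonormal_frame_def)
  ultimately show ind: "independent (b ` {..<k})"
    by (rule pairwise_orthogonal_independent)
  show "dim (span (b ` {..<k})) = k"
    using dim_span_eq_card_independent[OF ind] card_image[OF inj] by simp
qed

section \<open>Gram volumes\<close>

lemma pad_cong:
  assumes "\<And>i j. i < k \<Longrightarrow> j < k \<Longrightarrow> T i j = T' i j"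
  shows "pad k T = pad k T'"
  using assms by (simp add: pad_def vec_eq_iff)

text \<open>The square root of the Gram determinant: the volume of the parallelepiped spanned by \<open>w 0, \<dots>, w (k - 1)\<close>. It depends on
inner products only, so no frame of the span has to be chosen.\<close>

definition gram_vol :: "nat \<Rightarrow> (nat \<Rightarrow> real^'d) \<Rightarrow> real" where
  "gram_vol k w = sqrt \<bar>det (pad k (\<lambda>i j. w i \<bullet> w j) :: real^('d bit0)^('d bit0))\<bar>"

lemma gram_vol_nonneg: "0 \<le> gram_vol k w"
  by (simp add: gram_vol_def)

lemma gram_vol_inner_cong:
  fixes w w' :: "nat \<Rightarrow> real^'d"
  assumes "\<And>i j. i < k \<Longrightarrow> j < k \<Longrightarrow> w i \<bullet> w j = w' i \<bullet> w' j"
  shows "gram_vol k w = gram_vol k w'"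
  unfolding gram_vol_def by (simp only: pad_cong[OF assms])

text \<open>If the vectors \<open>w\<close> arise from \<open>u\<close> by the coefficient matrix \<open>W\<close>, their Gram matrices satisfy
\<open>G(w) = W\<^sup>T G(u) W\<close>.\<close>

lemma gram_vol_combination:
  fixes u w :: "nat \<Rightarrow> real^'d"
  assumes k: "k \<le> CARD('d)" and w: "\<And>j. j < k \<Longrightarrow> w j = (\<Sum>i<k. W i j *\<^sub>R u i)"
  shows "gram_vol k w = \<bar>det (pad k W :: real^('d bit0)^('d bit0))\<bar> * gram_vol k u"
proof -
  have k': "k \<le> CARD('d bit0)" using k by simp
  let ?W = "pad k W :: real^('d bit0)^('d bit0)"
  let ?U = "pad k (\<lambda>i j. u i \<bullet> u j) :: real^('d bit0)^('d bit0)"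
  have left: "w i \<bullet> v = (\<Sum>l<k. W l i * (u l \<bullet> v))" if "i < k" for i v
    by (simp add: w[OF that] inner_sum_left)
  have right: "v \<bullet> w j = (\<Sum>m<k. (v \<bullet> u m) * W m j)" if "j < k" for j v
    by (simp add: w[OF that] inner_sum_right mult.commute)
  have "(pad k (\<lambda>i j. w i \<bullet> w j) :: real^('d bit0)^('d bit0))
      = pad k (\<lambda>i j. \<Sum>l<k. W l i * (\<Sum>m<k. (u l \<bullet> u m) * W m j))"
    by (rule pad_cong) (subst left, assumption, subst right, assumption, rule refl)
  also have "\<dots> = transpose ?W ** (?U ** ?W)"
    by (simp add: transpose_pad pad_mult_pad[OF k'])
  finally show ?thesis
    by (simp add: gram_vol_def det_mul det_transpose abs_mult real_sqrt_mult)
qed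

lemma gram_vol_frame:
  fixes b :: "nat \<Rightarrow> real^'d"
  assumes "orthonormal_frame k b"
  shows "gram_vol k b = 1"
proof -
  have "(pad k (\<lambda>i j. b i \<bullet> b j) :: real^('d bit0)^('d bit0)) = mat 1"
    using assms by (auto simp: pad_def mat_def vec_eq_iff orthonormal_frame_def)
  then show ?thesis by (simp add: gram_vol_def)
qed

text \<open>Both sides expand over the frame \<open>b\<close> with the same coefficient matrix. So \<open>F\<close> multiplies the volume of
every parallelepiped in the span of \<open>b\<close> by the same factor.\<close>

lemma gram_vol_linear:
  fixes F :: "real^'d \<Rightarrow> real^'d"
  assumes k: "k \<le> CARD('d)" and F: "linear F" and b: "orthonormal_frame k b"
    and w: "\<And>j. j < k \<Longrightarrow> w j \<in> span (b ` {..<k})"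
  shows "gram_vol k (\<lambda>j. F (w j)) = gram_vol k (\<lambda>j. F (b j)) * gram_vol k w"
proof -
  have wb: "w j = (\<Sum>i<k. (w j \<bullet> b i) *\<^sub>R b i)" if "j < k" for j
    using in_span_frame[OF b w[OF that]] by simp
  have "F (w j) = (\<Sum>i<k. (w j \<bullet> b i) *\<^sub>R F (b i))" if "j < k" for j
    by (subst wb[OF that]) (simp add: linear_sum[OF F] linear_scale[OF F])
  from gram_vol_combination[OF k this] gram_vol_combination[OF k wb]
  show ?thesis by (simp add: gram_vol_frame[OF b])
qed

lemma abs_det_frames:
  fixes w b' :: "nat \<Rightarrow> real^'d"
  assumes k: "k \<le> CARD('d)" and b': "orthonormal_frame k b'"
    and w: "\<And>j. j < k \<Longrightarrow> w j \<in> span (b' ` {..<k})"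
  shows "\<bar>det (pad k (\<lambda>i j. w j \<bullet> b' i) :: real^('d bit0)^('d bit0))\<bar> = gram_vol k w"
proof -
  have "w j = (\<Sum>i<k. (w j \<bullet> b' i) *\<^sub>R b' i)" if "j < k" for j
    using in_span_frame[OF b' w[OF that]] by simp
  from gram_vol_combination[OF k this] show ?thesis
    by (simp add: gram_vol_frame[OF b'])
qed

lemma span_image_sum:
  assumes "x \<in> span (w ` {..<k::nat})"
  shows "\<exists>t. x = (\<Sum>i<k. t i *\<^sub>R w i)"
  using assms
proof (induction x rule: span_induct_alt)
  case base
  then show ?case by (auto intro: exI[of _ "\<lambda>_. 0"])
next
  case (step c y z)
  then obtain j t where j: "j < k" "y = w j" and t: "z = (\<Sum>i<k. t i *\<^sub>R w i)" by auto
  have "(\<Sum>i<k. (t i + (if i = j then c else 0)) *\<^sub>R w i) = z + (\<Sum>i<k. if i = j then c *\<^sub>R w i else 0)"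
    unfolding t sum.distrib[symmetric] by (intro sum.cong) (auto simp: scaleR_add_left)
  also have "\<dots> = c *\<^sub>R y + z"
    using j by (simp add: add.commute)
  finally show ?case by metis
qed

text \<open>If the vectors lie in the span of the first \<open>m < k\<close> vectors of a frame, their coefficient matrix has
a zero row, namely the one that belongs to the last frame vector.\<close>

lemma gram_vol_degenerate:
  fixes w :: "nat \<Rightarrow> real^'d"
  assumes k: "k \<le> CARD('d)" and dim: "dim (span (w ` {..<k})) < k"
  shows "gram_vol k w = 0"
proof -
  let ?m = "dim (span (w ` {..<k}))"
  \<comment> \<open>The last frame vector \<open>b (k - 1)\<close> is orthogonal to the span because \<open>?m < k\<close>.\<close>
  obtain b where b: "orthonormal_frame k b" "span (b ` {..<?m}) = span (w ` {..<k})"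
    by (rule frame_around[of "span (w ` {..<k})" k]) (use k dim in \<open>auto simp: subspace_span\<close>)
  have w: "w j \<in> span (b ` {..<?m})" if "j < k" for j
    using that unfolding b(2) by (auto intro: span_base)
  then have "w j \<in> span (b ` {..<k})" if "j < k" for j
    using that span_mono[of "b ` {..<?m}" "b ` {..<k}"] dim by force
  from abs_det_frames[OF k b(1) this]
  have *: "\<bar>det (pad k (\<lambda>i j. w j \<bullet> b i) :: real^('d bit0)^('d bit0))\<bar> = gram_vol k w" .
  have zero: "w j \<bullet> b (k - 1) = 0" if j: "j < k" for j
  proof -
    obtain t where "w j = (\<Sum>i<?m. t i *\<^sub>R b i)"
      using span_image_sum[OF w[OF j]] by auto
    moreover have "b i \<bullet> b (k - 1) = 0" if "i < ?m" for i
      using b(1) dim that unfolding orthonormal_frame_def by auto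
    ultimately show ?thesis
      by (simp add: inner_sum_left)
  qed
  let ?a = "coord_of (k - 1) :: 'd bit0"
  have a: "coord_index ?a = k - 1" "k - 1 < k"
    using k dim by auto
  have "row ?a (pad k (\<lambda>i j. w j \<bullet> b i)) = 0"
    using zero a by (auto simp: row_def pad_def vec_eq_iff)
  then have "det (pad k (\<lambda>i j. w j \<bullet> b i) :: real^('d bit0)^('d bit0)) = 0"
    by (rule det_zero_row(2))
  with * show ?thesis by simp
qed

text \<open>An orthonormal basis of the span is a combination of the \<open>w i\<close> and has Gram volume \<open>1\<close>, which by
\<open>gram_vol_combination\<close> is a multiple of the Gram volume of \<open>w\<close>.\<close>

lemma gram_vol_pos:
  fixes w :: "nat \<Rightarrow> real^'d"
  assumes k: "k \<le> CARD('d)" and dim: "dim (span (w ` {..<k})) = k"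
  shows "0 < gram_vol k w"
proof -
  obtain b where b: "orthonormal_frame k b" "span (b ` {..<k}) = span (w ` {..<k})"
    using subspace_frame[OF subspace_span[of "w ` {..<k}"]] unfolding dim by blast
  have "\<exists>t. b j = (\<Sum>i<k. t i *\<^sub>R w i)" if "j < k" for j
    by (rule span_image_sum) (use that in \<open>auto simp flip: b(2) intro: span_base\<close>)
  then obtain V where "\<And>j. j < k \<Longrightarrow> b j = (\<Sum>i<k. V j i *\<^sub>R w i)"
    by metis
  from gram_vol_combination[OF k, of b "\<lambda>i j. V j i" w, OF this]
  have "gram_vol k w \<noteq> 0"
    using gram_vol_frame[OF b(1)] by auto
  then show ?thesis using gram_vol_nonneg[of k w] by linarith
qed

section \<open>Volumes of linear images and of simplices\<close>

text \<open>Here \<open>w\<close> may be linearly dependent; images of a frame under a singular map are covered.\<close>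

lemma frame_spanning:
  fixes w :: "nat \<Rightarrow> 'a::euclidean_space"
  assumes "k \<le> DIM('a)"
  obtains b where "orthonormal_frame k b" "span (w ` {..<k}) \<subseteq> span (b ` {..<k})"
proof -
  let ?L = "span (w ` {..<k})"
  have dim: "dim ?L \<le> k"
    using dim_le_card'[of "w ` {..<k}"] card_image_le[of "{..<k}" w]
    by (simp add: dim_span)
  obtain b where b: "orthonormal_frame k b" "span (b ` {..<dim ?L}) = ?L"
    by (rule frame_around[OF subspace_span dim assms])
  have "span (b ` {..<dim ?L}) \<subseteq> span (b ` {..<k})"
    using dim by (intro span_mono) auto
  then show ?thesis using b that by blast
qed

lemma flat_volume_linear_image:
  fixes F :: "real^'d \<Rightarrow> real^'d"
  assumes k: "k \<le> CARD('d)" and F: "linear F" and b: "orthonormal_frame k b"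
    and S: "compact S" "S \<subseteq> range (frame_map k p b)"
  shows "flat_volume k (F ` S) = gram_vol k (\<lambda>j. F (b j)) * flat_volume k S"
proof -
  let ?L = "span ((\<lambda>j. F (b j)) ` {..<k})"
  have k': "k \<le> CARD('d bit0)" using k by simp
  obtain b' where b': "orthonormal_frame k b'" and L: "?L \<subseteq> span (b' ` {..<k})"
    by (rule frame_spanning[of k "\<lambda>j. F (b j)"]) (use k in simp)
  have Fb: "F (b j) \<in> span (b' ` {..<k})" if "j < k" for j
    using that L by (auto intro: span_base)
  have "F x - F p \<in> span (b' ` {..<k})" if "x \<in> S" for x
  proof -
    have "x - p \<in> span (b ` {..<k})"
      using S(2) that range_frame_map[OF b] by blast
    then have "F (x - p) \<in> F ` span (b ` {..<k})" by blast
    also have "\<dots> = ?L"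
      using span_linear_image[OF F, of "b ` {..<k}"] by (simp add: image_comp o_def)
    finally show ?thesis using L by (auto simp: linear_diff[OF F])
  qed
  then have sub: "F ` S \<subseteq> range (frame_map k (F p) b')"
    using range_frame_map[OF b'] by auto
  have "compact (F ` S)"
    by (rule compact_linear_image[OF F S(1)])
  then have "flat_volume k (F ` S) = frame_volume k (F p) b' (F ` S)"
    by (rule flat_volume_eq_frame_volume[OF k b' sub])
  also have "\<dots> = \<bar>det (pad k (\<lambda>i j. F (b j) \<bullet> b' i) :: real^('d bit0)^('d bit0))\<bar> * frame_volume k p b S"
    by (rule frame_volume_linear_image[OF k' b b' F S sub])
  also have "\<bar>det (pad k (\<lambda>i j. F (b j) \<bullet> b' i) :: real^('d bit0)^('d bit0))\<bar> = gram_vol k (\<lambda>j. F (b j))"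
    by (rule abs_det_frames[OF k b' Fb])
  also have "frame_volume k p b S = flat_volume k S"
    using flat_volume_eq_frame_volume[OF k b S(2,1)] by simp
  finally show ?thesis .
qed

lemma flat_volume_translation:
  fixes S :: "(real^'d) set"
  assumes k: "k \<le> CARD('d)" and b: "orthonormal_frame k b"
    and S: "compact S" "S \<subseteq> range (frame_map k p b)"
  shows "flat_volume k ((+) a ` S) = flat_volume k S"
proof -
  have map: "frame_map k (a + p) b t = a + frame_map k p b t" for t
    by (simp add: frame_map_def)
  have "frame_volume k (a + p) b ((+) a ` S) = frame_volume k p b S"
    by (simp add: frame_volume_def map image_iff)
  moreover have "(+) a ` S \<subseteq> range (frame_map k (a + p) b)"
    using S(2) unfolding map by blast
  ultimately show ?thesis
    using flat_volume_eq_frame_volume[OF k b] S by (simp add: compact_translation)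
qed

text \<open>Every simplex is a translated linear image of one fixed orthonormal simplex, whose volume is the
constant \<open>s\<close>, a common factor of the two random variables that are compared in the end.\<close>

lemma flat_volume_simplex:
  assumes k: "k \<le> CARD('d)"
  shows "\<exists>s. \<forall>x :: nat \<Rightarrow> real^'d.
     flat_volume k (convex hull (x ` {..k})) = s * gram_vol k (\<lambda>i. x (Suc i) - x 0)"
proof -
  obtain c :: "nat \<Rightarrow> real^'d" where c: "orthonormal_frame k c"
    by (rule frame_spanning[of k "\<lambda>_. 0"]) (use k in auto)
  define D where "D = convex hull (insert 0 (c ` {..<k}))"
  have D: "compact D"
    unfolding D_def by (intro compact_convex_hull finite_imp_compact) auto
  have "D \<subseteq> span (c ` {..<k})"
    unfolding D_def by (intro hull_minimal subspace_imp_convex[OF subspace_span]) (auto intro: span_base span_zero)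
  then have Dc: "D \<subseteq> range (frame_map k 0 c)"
    using range_frame_map[OF c, of _ 0] by auto
  have "flat_volume k (convex hull (x ` {..k})) = flat_volume k D * gram_vol k (\<lambda>i. x (Suc i) - x 0)"
    for x :: "nat \<Rightarrow> real^'d"
  proof -
    define F where "F y = (\<Sum>i<k. (y \<bullet> c i) *\<^sub>R (x (Suc i) - x 0))" for y
    have F: "linear F"
      unfolding F_def by (rule linearI)
        (simp_all add: inner_add_left scaleR_add_left sum.distrib scaleR_sum_right)
    have Fc: "F (c j) = x (Suc j) - x 0" if "j < k" for j
    proof -
      have "F (c j) = (\<Sum>i<k. if i = j then x (Suc i) - x 0 else 0)"
        unfolding F_def using c that by (intro sum.cong) (auto simp: orthonormal_frame_def)
      then show ?thesis using that by simp
    qed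
    have "(\<lambda>y. x 0 + F y) ` insert 0 (c ` {..<k}) = x ` {..k}"
    proof -
      have "(\<lambda>y. x 0 + F y) ` insert 0 (c ` {..<k}) = insert (x 0) (x ` Suc ` {..<k})"
        using linear_0[OF F] Fc by (auto simp: image_iff)
      also have "\<dots> = x ` insert 0 (Suc ` {..<k})" by simp
      also have "insert 0 (Suc ` {..<k}) = {..k}"
        by (metis lessThan_Suc_atMost lessThan_Suc_eq_insert_0)
      finally show ?thesis .
    qed
    then have hull: "convex hull (x ` {..k}) = (+) (x 0) ` F ` D"
      unfolding D_def convex_hull_linear_image[OF F] convex_hull_translation[symmetric]
      by (simp add: image_comp o_def)
    let ?L = "span ((\<lambda>j. F (c j)) ` {..<k})"
    obtain b where b: "orthonormal_frame k b" "?L \<subseteq> span (b ` {..<k})"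
      by (rule frame_spanning[of k "\<lambda>j. F (c j)"]) (use k in simp)
    have "F ` D \<subseteq> F ` span (c ` {..<k})"
      using \<open>D \<subseteq> span (c ` {..<k})\<close> by blast
    also have "\<dots> = ?L"
      using span_linear_image[OF F, of "c ` {..<k}"] by (simp add: image_comp o_def)
    also note b(2)
    finally have "F ` D \<subseteq> range (frame_map k 0 b)"
      using range_frame_map[OF b(1), of _ 0] by auto
    moreover have "compact (F ` D)"
      by (rule compact_linear_image[OF F D])
    ultimately have "flat_volume k (convex hull (x ` {..k})) = flat_volume k (F ` D)"
      unfolding hull using flat_volume_translation[OF k b(1)] by simp
    also have "\<dots> = gram_vol k (\<lambda>j. F (c j)) * flat_volume k D"
      by (rule flat_volume_linear_image[OF k F c D Dc])
    also have "gram_vol k (\<lambda>j. F (c j)) = gram_vol k (\<lambda>i. x (Suc i) - x 0)"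
      by (rule gram_vol_inner_cong) (simp add: Fc)
    finally show ?thesis by simp
  qed
  then show ?thesis by blast
qed

section \<open>Orthogonal projections and rotations\<close>

lemma orth_proj_eqI:
  assumes L: "subspace L" and y: "y \<in> L" "\<And>z. z \<in> L \<Longrightarrow> (x - y) \<bullet> z = 0"
  shows "orth_proj L x = y"
  unfolding orth_proj_def
proof (rule the_equality)
  show "y \<in> L \<and> (\<forall>z\<in>L. orthogonal (x - y) z)"
    using y by (simp add: orthogonal_def)
next
  fix y' assume y': "y' \<in> L \<and> (\<forall>z\<in>L. orthogonal (x - y') z)"
  then have d: "y - y' \<in> L" using L y(1) by (simp add: subspace_diff)
  have "(y - y') \<bullet> (y - y') = (x - y') \<bullet> (y - y') - (x - y) \<bullet> (y - y')"
    by (simp add: inner_diff_left)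
  also have "\<dots> = 0" using y(2)[OF d] y' d by (simp add: orthogonal_def)
  finally show "y' = y" by simp
qed

lemma orth_proj_frame:
  assumes "orthonormal_frame k b"
  shows "orth_proj (span (b ` {..<k})) x = (\<Sum>i<k. (x \<bullet> b i) *\<^sub>R b i)"
proof (rule orth_proj_eqI[OF subspace_span])
  show "(\<Sum>i<k. (x \<bullet> b i) *\<^sub>R b i) \<in> span (b ` {..<k})"
    by (intro span_sum span_scale) (auto intro: span_base)
next
  fix z assume "z \<in> span (b ` {..<k})"
  from in_span_frame[OF assms this] have z: "z = (\<Sum>i<k. (z \<bullet> b i) *\<^sub>R b i)" ..
  have "(\<Sum>i<k. (x \<bullet> b i) *\<^sub>R b i) \<bullet> z = (\<Sum>i<k. (z \<bullet> b i) * (x \<bullet> b i))"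
    unfolding inner_sum_left by (intro sum.cong) (simp_all add: inner_commute mult.commute)
  also have "\<dots> = x \<bullet> (\<Sum>i<k. (z \<bullet> b i) *\<^sub>R b i)"
    by (simp add: inner_sum_right)
  also have "\<dots> = x \<bullet> z"
    by (simp flip: z)
  finally show "(x - (\<Sum>i<k. (x \<bullet> b i) *\<^sub>R b i)) \<bullet> z = 0"
    by (simp add: inner_diff_left)
qed

lemma orth_proj_props:
  fixes L :: "'a::euclidean_space set"
  assumes "subspace L"
  shows "orth_proj L x \<in> L" "z \<in> L \<Longrightarrow> (x - orth_proj L x) \<bullet> z = 0" "linear (orth_proj L)"
    "z \<in> L \<Longrightarrow> orth_proj L z = z"
proof -
  obtain b where b: "orthonormal_frame (dim L) b" "span (b ` {..<dim L}) = L"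
    using subspace_frame[OF assms] by blast
  have eq: "orth_proj L x = (\<Sum>i<dim L. (x \<bullet> b i) *\<^sub>R b i)" for x
    using orth_proj_frame[OF b(1)] b(2) by simp
  show "linear (orth_proj L)"
    unfolding eq by (rule linearI)
      (simp_all add: inner_add_left scaleR_add_left sum.distrib scaleR_sum_right)
  have "(\<Sum>i<dim L. (x \<bullet> b i) *\<^sub>R b i) \<in> span (b ` {..<dim L})"
    by (intro span_sum span_scale) (auto intro: span_base)
  then show mem: "orth_proj L x \<in> L" by (simp add: eq b(2))
  show "z \<in> L \<Longrightarrow> orth_proj L z = z"
    by (rule orth_proj_eqI[OF assms]) auto
  show "(x - orth_proj L x) \<bullet> z = 0" if "z \<in> L"
  proof -
    have "(\<Sum>i<dim L. (z \<bullet> b i) *\<^sub>R b i) = z"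
      using in_span_frame[OF b(1)] that b(2) by simp
    then have "x \<bullet> z = (\<Sum>i<dim L. (z \<bullet> b i) * (x \<bullet> b i))"
      by (metis (no_types, lifting) inner_scaleR_right inner_sum_right sum.cong)
    also have "\<dots> = orth_proj L x \<bullet> z"
      unfolding eq inner_sum_left by (intro sum.cong) (simp_all add: inner_commute mult.commute)
    finally show ?thesis by (simp add: inner_diff_left)
  qed
qed

text \<open>The point of the space of matrices that represents \<open>L\<close> in the topology of the Grassmannian.\<close>

definition proj_matrix :: "(real^'d) set \<Rightarrow> real^'d^'d" where
  "proj_matrix L = matrix (orth_proj L)"

lemma proj_matrix_mult:
  assumes "subspace L"
  shows "proj_matrix L *v x = orth_proj L x"
  unfolding proj_matrix_def by (simp add: matrix_works orth_proj_props(3)[OF assms])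

lemma orthogonal_matrix_inner:
  fixes U :: "real^'d^'d"
  assumes "orthogonal_matrix U"
  shows "(U *v x) \<bullet> (U *v y) = x \<bullet> y"
  using assms by (simp add: dot_lmul_matrix[symmetric] matrix_vector_mul_assoc
      orthogonal_matrix_def vector_transpose_matrix dot_matrix_vector_mul flip: transpose_matrix_vector)

lemma proj_matrix_rotate:
  fixes U :: "real^'d^'d"
  assumes U: "orthogonal_matrix U" and L: "subspace L"
  shows "proj_matrix ((*v) U ` L) = U ** proj_matrix L ** transpose U"
proof -
  have UL: "subspace ((*v) U ` L)"
    by (rule linear_subspace_image[OF matrix_vector_mul_linear L])
  have "orth_proj ((*v) U ` L) x = U *v orth_proj L (transpose U *v x)" for x
  proof (rule orth_proj_eqI[OF UL])
    show "U *v orth_proj L (transpose U *v x) \<in> (*v) U ` L"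
      using orth_proj_props(1)[OF L] by blast
  next
    fix z assume "z \<in> (*v) U ` L"
    then obtain z' where z': "z' \<in> L" "z = U *v z'" by auto
    have x: "x = U *v (transpose U *v x)"
      using U unfolding matrix_vector_mul_assoc by (simp add: orthogonal_matrix_def)
    have "(x - U *v orth_proj L (transpose U *v x)) \<bullet> z
        = (U *v (transpose U *v x - orth_proj L (transpose U *v x))) \<bullet> (U *v z')"
      unfolding matrix_vector_mult_diff_distrib x[symmetric] z'(2) ..
    also have "\<dots> = (transpose U *v x - orth_proj L (transpose U *v x)) \<bullet> z'"
      by (rule orthogonal_matrix_inner[OF U])
    also have "\<dots> = 0" by (rule orth_proj_props(2)[OF L z'(1)])
    finally show "(x - U *v orth_proj L (transpose U *v x)) \<bullet> z = 0" .
  qed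
  then show ?thesis
    by (simp add: matrix_eq proj_matrix_mult[OF UL] proj_matrix_mult[OF L]
        flip: matrix_vector_mul_assoc)
qed

lemma dim_rotate:
  fixes U :: "real^'d^'d"
  assumes U: "orthogonal_matrix U"
  shows "dim ((*v) U ` L) = dim L"
proof (rule dim_image_eq[OF matrix_vector_mul_linear])
  have "inj ((*v) U)"
    by (rule injI) (metis U matrix_vector_mul_assoc matrix_vector_mul_lid orthogonal_matrix_def)
  then show "inj_on ((*v) U) (span L)" by (rule inj_on_subset) simp
qed

text \<open>Complete orthonormal bases of the two subspaces to orthonormal bases of the whole space, and map one to
the other.\<close>

lemma rotation_between_subspaces:
  fixes L L' :: "(real^'d) set"
  assumes L: "subspace L" and L': "subspace L'" and dim: "dim L = dim L'"
  obtains U where "orthogonal_matrix U" "(*v) U ` L = L'"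
proof -
  let ?d = "CARD('d)"
  have dimL: "dim L \<le> ?d" "dim L' \<le> ?d"
    using dim_subset_UNIV[of L] dim_subset_UNIV[of L'] by simp_all
  obtain b where b: "orthonormal_frame ?d b" "span (b ` {..<dim L}) = L"
    by (rule frame_around[OF L dimL(1)]) simp
  obtain b' where b': "orthonormal_frame ?d b'" "span (b' ` {..<dim L'}) = L'"
    by (rule frame_around[OF L' dimL(2)]) simp
  define F where "F x = (\<Sum>i<?d. (x \<bullet> b i) *\<^sub>R b' i)" for x
  have F: "linear F"
    unfolding F_def by (rule linearI)
      (simp_all add: inner_add_left scaleR_add_left sum.distrib scaleR_sum_right)
  have Fb: "F (b j) = b' j" if "j < ?d" for j
  proof -
    have "F (b j) = (\<Sum>i<?d. if i = j then b' i else 0)"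
      unfolding F_def using b(1) that by (intro sum.cong) (auto simp: orthonormal_frame_def)
    then show ?thesis using that by simp
  qed
  have span: "span (b ` {..<?d}) = UNIV"
    using independent_frame(3)[OF b(1)] dim_eq_full[of "b ` {..<?d}"] by (simp add: dim_span)
  have "F x \<bullet> F x = x \<bullet> x" for x
  proof -
    have "F x \<bullet> F x = (\<Sum>i<?d. (x \<bullet> b i) * (F x \<bullet> b' i))"
      by (subst (2) F_def) (simp add: inner_sum_right)
    also have "\<dots> = (\<Sum>i<?d. (x \<bullet> b i) * (x \<bullet> b i))"
      unfolding F_def using inner_frame_sum[OF b'(1)] by simp
    also have "\<dots> = x \<bullet> (\<Sum>i<?d. (x \<bullet> b i) *\<^sub>R b i)"
      by (simp add: inner_sum_right)
    also have "\<dots> = x \<bullet> x"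
      using in_span_frame[OF b(1), of x] span by simp
    finally show ?thesis .
  qed
  then have "orthogonal_transformation F"
    by (simp add: orthogonal_transformation F norm_eq_sqrt_inner)
  then have U: "orthogonal_matrix (matrix F)"
    by (simp add: orthogonal_transformation_matrix)
  have "(*v) (matrix F) ` L = F ` span (b ` {..<dim L})"
    by (simp add: matrix_works F b(2))
  also have "\<dots> = span ((\<lambda>j. F (b j)) ` {..<dim L})"
    using span_linear_image[OF F, of "b ` {..<dim L}"] by (simp add: image_comp o_def)
  also have "(\<lambda>j. F (b j)) ` {..<dim L} = b' ` {..<dim L}"
    using Fb dimL by (intro image_cong) auto
  also have "span (b' ` {..<dim L}) = L'" using b'(2) dim by simp
  finally show ?thesis using that U by blast
qed

section \<open>Volume of the projected ellipsoid\<close>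

lemma matrix_inv_eqI:
  fixes A B :: "real^'d^'d"
  assumes "A ** B = mat 1" "B ** A = mat 1"
  shows "matrix_inv A = B"
  unfolding matrix_inv_def
proof (rule some_equality)
  fix C assume C: "A ** C = mat 1 \<and> C ** A = mat 1"
  have "C = C ** (A ** B)" using assms by simp
  also have "\<dots> = B" using C by (simp add: matrix_mul_assoc)
  finally show "C = B" .
qed (use assms in simp)

text \<open>Substitute \<open>x = A\<^sup>T y\<close>: the quadratic form becomes \<open>y \<bullet> y\<close>.\<close>

lemma ellipsoid_eq_image_cball:
  fixes A :: "real^'d^'d"
  assumes "invertible A"
  shows "{x. x \<bullet> (matrix_inv (transpose A ** A) *v x) \<le> 1} = (*v) (transpose A) ` cball 0 1"
proof -
  obtain B where AB: "A ** B = mat 1" "B ** A = mat 1"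
    using assms unfolding invertible_def by blast
  have tAB: "transpose A ** transpose B = mat 1" "transpose B ** transpose A = mat 1"
    by (simp_all add: AB flip: matrix_transpose_mul)
  have inv: "matrix_inv (transpose A ** A) = B ** transpose B"
  proof (rule matrix_inv_eqI)
    have "transpose A ** A ** (B ** transpose B) = transpose A ** (A ** B) ** transpose B"
      by (simp only: matrix_mul_assoc)
    then show "transpose A ** A ** (B ** transpose B) = mat 1" by (simp add: AB tAB)
    have "B ** transpose B ** (transpose A ** A) = B ** (transpose B ** transpose A) ** A"
      by (simp only: matrix_mul_assoc)
    then show "B ** transpose B ** (transpose A ** A) = mat 1" by (simp add: AB tAB)
  qed
  have quad: "x \<bullet> (matrix_inv (transpose A ** A) *v x) = (transpose B *v x) \<bullet> (transpose B *v x)" for x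
    unfolding inv by (simp add: dot_lmul_matrix flip: matrix_vector_mul_assoc)
  show ?thesis
  proof (intro set_eqI iffI)
    fix x assume "x \<in> {x. x \<bullet> (matrix_inv (transpose A ** A) *v x) \<le> 1}"
    then have "transpose B *v x \<in> cball 0 1"
      by (simp add: quad norm_eq_sqrt_inner)
    moreover have "x = transpose A *v (transpose B *v x)"
      unfolding matrix_vector_mul_assoc tAB by simp
    ultimately show "x \<in> (*v) (transpose A) ` cball 0 1" by blast
  next
    fix x assume "x \<in> (*v) (transpose A) ` cball 0 1"
    then obtain y where y: "norm y \<le> 1" "x = transpose A *v y" by auto
    have "transpose B *v x = y"
      unfolding y(2) matrix_vector_mul_assoc tAB by simp
    then show "x \<in> {x. x \<bullet> (matrix_inv (transpose A ** A) *v x) \<le> 1}"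
      using y(1) by (simp add: quad norm_eq_sqrt_inner)
  qed
qed

lemma norm_frame_sum:
  assumes "orthonormal_frame k b"
  shows "norm (\<Sum>i<k. t i *\<^sub>R b i) = sqrt (\<Sum>i<k. (t i)\<^sup>2)"
proof -
  have "(\<Sum>i<k. t i *\<^sub>R b i) \<bullet> (\<Sum>j<k. t j *\<^sub>R b j) = (\<Sum>i<k. t i * ((\<Sum>j<k. t j *\<^sub>R b j) \<bullet> b i))"
    by (subst inner_sum_right) simp
  also have "\<dots> = (\<Sum>i<k. (t i)\<^sup>2)"
    using inner_frame_sum[OF assms, of _ t] by (simp add: power2_eq_square)
  finally show ?thesis by (simp add: norm_eq_sqrt_inner)
qed

lemma frame_volume_ball:
  assumes "orthonormal_frame k b"
  shows "frame_volume k 0 b (span (b ` {..<k}) \<inter> cball 0 1) = unit_ball_vol (real k)"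
proof -
  let ?P = "Pi\<^sub>M {..<k} (\<lambda>_. lborel :: real measure)"
  have "frame_map k 0 b t \<in> span (b ` {..<k}) \<inter> cball 0 1 \<longleftrightarrow> sqrt (\<Sum>i<k. (t i)\<^sup>2) \<le> 1" for t
    using range_frame_map[OF assms, of "frame_map k 0 b t" 0] norm_frame_sum[OF assms, of t]
    by (simp add: frame_map_def)
  then have "frame_coords k 0 b (span (b ` {..<k}) \<inter> cball 0 1)
      = {t. sqrt (\<Sum>i<k. (t i)\<^sup>2) \<le> 1} \<inter> space ?P"
    by (auto simp: frame_coords_def space_PiM)
  then show ?thesis
    using emeasure_cball_aux[of "{..<k}" 1]
    by (simp add: frame_volume_coords measure_def unit_ball_vol_nonneg)
qed

text \<open>Let \<open>b'\<close> be a frame whose span \<open>L'\<close> contains the image of \<open>L\<close> under \<open>A\<close>. The map \<open>F = P\<^sub>L A\<^sup>T\<close> does not see the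
component orthogonal to \<open>L'\<close>, so the projected ellipsoid is the image of the unit ball of \<open>L'\<close> under \<open>F\<close>. On
\<open>L'\<close> the map \<open>F\<close> is the adjoint of \<open>A : L \<rightarrow> L'\<close>, and its matrix in the two frames is the transpose of that of \<open>A\<close>.\<close>

lemma flat_volume_projected_ellipsoid:
  fixes A :: "real^'d^'d"
  assumes k: "k \<le> CARD('d)" and b: "orthonormal_frame k b"
  shows "flat_volume k (orth_proj (span (b ` {..<k})) ` (*v) (transpose A) ` cball 0 1)
    = unit_ball_vol (real k) * gram_vol k (\<lambda>j. A *v b j)"
proof -
  let ?L = "span (b ` {..<k})"
  have k': "k \<le> CARD('d bit0)" using k by simp
  obtain b' where b': "orthonormal_frame k b'"
    and "span ((\<lambda>j. A *v b j) ` {..<k}) \<subseteq> span (b' ` {..<k})"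
    by (rule frame_spanning[of k "\<lambda>j. A *v b j"]) (use k in simp)
  then have Ab: "A *v b j \<in> span (b' ` {..<k})" if "j < k" for j
    using that by (auto intro: span_base)
  let ?L' = "span (b' ` {..<k})"
  define F where "F y = orth_proj ?L (transpose A *v y)" for y
  have F: "linear F"
    unfolding F_def
    using linear_compose[OF matrix_vector_mul_linear[of "transpose A"] orth_proj_props(3)[of ?L]]
    by (simp add: o_def subspace_span)
  have F_sum: "F y = (\<Sum>i<k. (y \<bullet> (A *v b i)) *\<^sub>R b i)" for y
    unfolding F_def orth_proj_frame[OF b] by (simp add: dot_lmul_matrix)
  have F_proj: "F y = F (orth_proj ?L' y)" for y
  proof -
    have "y \<bullet> (A *v b i) = orth_proj ?L' y \<bullet> (A *v b i)" if "i < k" for i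
      using orth_proj_props(2)[OF subspace_span Ab[OF that], of y] by (simp add: inner_diff_left)
    then show ?thesis by (simp add: F_sum)
  qed
  have "norm (orth_proj ?L' y) \<le> norm y" for y
  proof -
    have "norm (orth_proj ?L' y) ^ 2 = orth_proj ?L' y \<bullet> y"
      using orth_proj_props(2)[OF subspace_span orth_proj_props(1)[OF subspace_span], of y "b' ` {..<k}"]
      unfolding inner_diff_left power2_norm_eq_inner by (simp add: inner_commute)
    also have "\<dots> \<le> norm (orth_proj ?L' y) * norm y" by (rule norm_cauchy_schwarz)
    finally show ?thesis
      by (cases "norm (orth_proj ?L' y) = 0") (auto simp: power2_eq_square)
  qed
  then have "orth_proj ?L' y \<in> ?L' \<inter> cball 0 1" if "y \<in> cball 0 1" for y
    using that orth_proj_props(1)[OF subspace_span] by (auto intro: order_trans)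
  then have "F ` cball 0 1 \<subseteq> F ` (?L' \<inter> cball 0 1)"
    using F_proj by (intro image_subsetI image_eqI)
  then have "F ` cball 0 1 = F ` (?L' \<inter> cball 0 1)" by blast
  then have image: "orth_proj ?L ` (*v) (transpose A) ` cball 0 1 = F ` (?L' \<inter> cball 0 1)"
    by (simp add: image_comp o_def flip: F_def del: transpose_matrix_vector)
  have S: "compact (?L' \<inter> cball 0 1)"
    by (simp add: closed_Int_compact closed_subspace subspace_span)
  have S': "?L' \<inter> cball 0 1 \<subseteq> range (frame_map k 0 b')"
    using range_frame_map[OF b', of _ 0] by auto
  have "F y \<in> ?L" for y unfolding F_def by (rule orth_proj_props(1)[OF subspace_span])
  then have sub: "F ` (?L' \<inter> cball 0 1) \<subseteq> range (frame_map k 0 b)"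
    using range_frame_map[OF b, of _ 0] by auto
  have "flat_volume k (F ` (?L' \<inter> cball 0 1)) = frame_volume k 0 b (F ` (?L' \<inter> cball 0 1))"
    by (rule flat_volume_eq_frame_volume[OF k b sub compact_linear_image[OF F S]])
  also have "\<dots> = \<bar>det (pad k (\<lambda>i j. F (b' j) \<bullet> b i) :: real^('d bit0)^('d bit0))\<bar>
      * frame_volume k 0 b' (?L' \<inter> cball 0 1)"
    by (rule frame_volume_linear_image[OF k' b' b F S S' sub])
  also have "(pad k (\<lambda>i j. F (b' j) \<bullet> b i) :: real^('d bit0)^('d bit0))
      = transpose (pad k (\<lambda>i j. (A *v b j) \<bullet> b' i))"
    unfolding transpose_pad
  proof (rule pad_cong)
    fix i j assume "i < k"
    then have "F (b' j) \<bullet> b i = b' j \<bullet> (A *v b i)"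
      unfolding F_sum by (rule inner_frame_sum[OF b])
    then show "F (b' j) \<bullet> b i = (A *v b i) \<bullet> b' j" by (simp add: inner_commute)
  qed
  also have "\<bar>det \<dots>\<bar> = gram_vol k (\<lambda>j. A *v b j)"
    unfolding det_transpose by (rule abs_det_frames[OF k b' Ab])
  finally show ?thesis
    unfolding image by (simp add: frame_volume_ball[OF b'])
qed

section \<open>The scaling factor as a measurable function of the direction\<close>

lemma gram_vol_measurable:
  fixes f :: "nat \<Rightarrow> 'm \<Rightarrow> real^'d"
  assumes "\<And>i. i < k \<Longrightarrow> f i \<in> borel_measurable N"
  shows "(\<lambda>x. gram_vol k (\<lambda>i. f i x)) \<in> borel_measurable N"
proof -
  have "(\<lambda>x. (pad k (\<lambda>i j. f i x \<bullet> f j x) :: real^('d bit0)^('d bit0)) $ a $ b) \<in> borel_measurable N" for a b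
    using assms by (cases "coord_index a < k \<and> coord_index b < k") (auto simp: pad_def)
  then have "(\<lambda>x. det (pad k (\<lambda>i j. f i x \<bullet> f j x) :: real^('d bit0)^('d bit0))) \<in> borel_measurable N"
    unfolding det_def by (intro borel_measurable_sum borel_measurable_times borel_measurable_const borel_measurable_prod)
  then show ?thesis
    unfolding gram_vol_def by measurable
qed

lemma measurable_matrix_vector_mult:
  fixes f :: "'m \<Rightarrow> real^'d^'e"
  assumes "f \<in> borel_measurable N" "g \<in> borel_measurable N"
  shows "(\<lambda>x. f x *v g x) \<in> borel_measurable N"
  by (rule borel_measurable_continuous_Pair[OF assms])
    (auto simp: matrix_vector_mult_def intro!: continuous_intros)

text \<open>The factor by which \<open>A\<close> multiplies volume in the range of the projection \<open>P\<close>, written without choosing a basis of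
the range: \<open>P\<close> projects \<open>k\<close>-tuples of standard basis vectors to vectors that span parallelepipeds in the range, and
\<open>A\<close> scales all their volumes by the same factor. Summing over all tuples avoids selecting a nondegenerate
one, and makes the expression a Borel function of \<open>P\<close>.\<close>

definition proj_scale :: "nat \<Rightarrow> real^'d^'d \<Rightarrow> real^'d^'d \<Rightarrow> real" where
  "proj_scale k A P = (\<Sum>I\<in>{..<k} \<rightarrow>\<^sub>E UNIV. gram_vol k (\<lambda>i. A *v (P *v axis (I i) 1)))
     / (\<Sum>I\<in>{..<k} \<rightarrow>\<^sub>E UNIV. gram_vol k (\<lambda>i. P *v axis (I i) 1))"

lemma proj_scale_measurable: "proj_scale k A \<in> borel_measurable borel"
  unfolding proj_scale_def
  by (intro borel_measurable_divide borel_measurable_sum gram_vol_measurable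
      measurable_matrix_vector_mult measurable_ident_sets measurable_const refl)
    auto

text \<open>Each summand of the numerator is the factor times the corresponding summand of the denominator. The denominator is
positive because the projected standard basis vectors span the range, so some \<open>k\<close> of them form a basis.\<close>

lemma proj_scale_eq:
  fixes A :: "real^'d^'d"
  assumes b: "orthonormal_frame k b" and k: "k \<le> CARD('d)"
  shows "proj_scale k A (proj_matrix (span (b ` {..<k}))) = gram_vol k (\<lambda>j. A *v b j)"
proof -
  let ?L = "span (b ` {..<k})"
  let ?P = "proj_matrix ?L"
  have P: "?P *v x = orth_proj ?L x" for x by (rule proj_matrix_mult[OF subspace_span])
  have PL: "?P *v x \<in> ?L" for x
    unfolding P by (rule orth_proj_props(1)[OF subspace_span])
  let ?V = "range (\<lambda>a. ?P *v axis a 1)"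
  have "?L \<subseteq> span ?V"
  proof
    fix y assume "y \<in> ?L"
    then have "y = ?P *v y" unfolding P by (simp add: orth_proj_props(4)[OF subspace_span])
    also have "\<dots> = (\<Sum>a\<in>UNIV. (y $ a) *\<^sub>R (?P *v axis a 1))"
    proof -
      have "y = (\<Sum>a\<in>UNIV. (y $ a) *\<^sub>R axis a 1)"
        using basis_expansion[of y] by (simp add: scalar_mult_eq_scaleR)
      from arg_cong[OF this, of "\<lambda>y. ?P *v y"] show ?thesis
        by (simp add: linear_sum[OF matrix_vector_mul_linear] matrix_vector_mult_scaleR)
    qed
    also have "\<dots> \<in> span ?V"
      by (intro span_sum span_scale) (auto intro: span_base)
    finally show "y \<in> span ?V" .
  qed
  moreover have "span ?V \<subseteq> ?L"
    by (rule span_minimal) (use PL subspace_span in auto)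
  ultimately have V: "span ?V = ?L" by blast
  obtain B where B: "B \<subseteq> ?V" "independent B" "?V \<subseteq> span B" "card B = dim ?V"
    by (rule basis_exists[of ?V])
  have "dim ?V = k"
    using V independent_frame(3)[OF b] by (metis dim_span)
  then obtain h where h: "bij_betw h {..<k} B"
    using ex_bij_betw_nat_finite[OF independent_imp_finite[OF B(2)]] B(4)
    by (auto simp: atLeast0LessThan)
  have "\<exists>a. h i = ?P *v axis a 1" if "i < k" for i
    using bij_betwE[OF h] B(1) that by auto
  then obtain I where I: "\<And>i. i < k \<Longrightarrow> h i = ?P *v axis (I i) 1" by metis
  let ?I = "restrict I {..<k}"
  have "span B = ?L"
    using B(1,3) V by (metis span_mono span_span subset_antisym)
  moreover have "(\<lambda>i. ?P *v axis (?I i) 1) ` {..<k} = B"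
    using h I by (auto simp: bij_betw_def image_iff)
  ultimately have "0 < gram_vol k (\<lambda>i. ?P *v axis (?I i) 1)"
    using independent_frame(3)[OF b] by (intro gram_vol_pos[OF k]) simp
  moreover have "finite ({..<k} \<rightarrow>\<^sub>E (UNIV :: 'd set))" by (intro finite_PiE) auto
  moreover have "?I \<in> {..<k} \<rightarrow>\<^sub>E UNIV" by auto
  ultimately have "0 < (\<Sum>I\<in>{..<k} \<rightarrow>\<^sub>E UNIV. gram_vol k (\<lambda>i. ?P *v axis (I i) 1))"
    using gram_vol_nonneg by (intro sum_pos2[of _ ?I]) auto
  moreover have "gram_vol k (\<lambda>i. A *v (?P *v axis (I i) 1))
      = gram_vol k (\<lambda>j. A *v b j) * gram_vol k (\<lambda>i. ?P *v axis (I i) 1)" for I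
    by (rule gram_vol_linear[OF k matrix_vector_mul_linear b PL])
  ultimately show ?thesis
    by (simp add: proj_scale_def flip: sum_distrib_left)
qed

section \<open>The direction of a simplex as a measurable function\<close>

text \<open>Gram-Schmidt orthogonalization in terms of projection matrices. As \<open>sgn 0 = 0\<close>, a vector that depends on
its predecessors leaves the projection unchanged, so no case distinction on linear dependence is needed.\<close>

primrec span_proj :: "(nat \<Rightarrow> real^'d) \<Rightarrow> nat \<Rightarrow> real^'d^'d" where
  "span_proj w 0 = 0"
| "span_proj w (Suc n) = span_proj w n +
     (let e = sgn (w n - span_proj w n *v w n) in \<chi> i j. e $ i * e $ j)"

lemma outer_mult:
  fixes e :: "real^'d"
  shows "(\<chi> i j. e $ i * e $ j) *v x = (x \<bullet> e) *\<^sub>R e"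
  by (simp add: vec_eq_iff matrix_vector_mult_def inner_vec_def sum_distrib_left mult_ac)

text \<open>The residual \<open>r\<close> of \<open>w n\<close> lies in the new span and is orthogonal to the old one. So adding the
projection to its line extends the projection by one dimension, or not at all if \<open>r = 0\<close>.\<close>

lemma span_proj_props:
  "span_proj w n *v x \<in> span (w ` {..<n}) \<and> (\<forall>z\<in>span (w ` {..<n}). (x - span_proj w n *v x) \<bullet> z = 0)"
proof (induction n arbitrary: x)
  case 0
  then show ?case by (simp add: span_zero)
next
  case (Suc n)
  let ?S = "span (w ` {..<n})" and ?S' = "span (w ` {..<Suc n})"
  let ?P = "span_proj w n"
  define r where "r = w n - ?P *v w n"
  define e where "e = sgn r"
  have P': "span_proj w (Suc n) *v x = ?P *v x + (x \<bullet> e) *\<^sub>R e"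
    by (simp add: Let_def matrix_vector_mult_add_rdistrib outer_mult r_def e_def)
  have sub: "?S \<subseteq> ?S'" by (intro span_mono) auto
  have wn: "w n \<in> ?S'" by (intro span_base) auto
  have "r \<in> ?S'" unfolding r_def using Suc sub wn by (intro span_diff) auto
  then have "e \<in> ?S'" unfolding e_def sgn_div_norm by (rule span_scale)
  then have mem: "span_proj w (Suc n) *v x \<in> ?S'"
    unfolding P' using Suc sub by (intro span_add span_scale) auto
  have r_perp: "r \<bullet> z = 0" if "z \<in> ?S" for z
    using Suc that unfolding r_def by blast
  then have e_perp: "e \<bullet> z = 0" if "z \<in> ?S" for z
    using that unfolding e_def sgn_div_norm by simp
  have old: "(x - span_proj w (Suc n) *v x) \<bullet> z = 0" if "z \<in> ?S" for z
    unfolding P' using Suc[of x] e_perp[OF that] that by (simp add: inner_diff_left inner_add_left)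
  have "(x - span_proj w (Suc n) *v x) \<bullet> r = x \<bullet> r - (?P *v x) \<bullet> r - (x \<bullet> e) * (e \<bullet> r)"
    unfolding P' by (simp add: inner_diff_left inner_add_left)
  also have "(?P *v x) \<bullet> r = 0"
    using r_perp[of "?P *v x"] Suc[of x] by (simp add: inner_commute)
  also have "(x \<bullet> e) * (e \<bullet> r) = x \<bullet> r"
    by (cases "r = 0") (simp_all add: e_def sgn_div_norm dot_square_norm power2_eq_square field_simps)
  finally have "(x - span_proj w (Suc n) *v x) \<bullet> r = 0" by simp
  moreover have "(x - span_proj w (Suc n) *v x) \<bullet> (?P *v w n) = 0"
    by (rule old) (use Suc in blast)
  ultimately have new: "(x - span_proj w (Suc n) *v x) \<bullet> w n = 0"
    by (simp add: r_def inner_diff_right)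
  have "(x - span_proj w (Suc n) *v x) \<bullet> z = 0" if "z \<in> ?S'" for z
  proof -
    have "orthogonal (x - span_proj w (Suc n) *v x) z"
      using that
    proof (rule orthogonal_to_span)
      fix y assume "y \<in> w ` {..<Suc n}"
      then show "orthogonal (x - span_proj w (Suc n) *v x) y"
        using new old by (auto simp: orthogonal_def less_Suc_eq span_base simp del: span_proj.simps)
    qed
    then show ?thesis by (simp add: orthogonal_def)
  qed
  with mem show ?case by blast
qed

lemma span_proj_eq: "span_proj w n = proj_matrix (span (w ` {..<n}))"
proof -
  have "span_proj w n *v x = proj_matrix (span (w ` {..<n})) *v x" for x
    unfolding proj_matrix_mult[OF subspace_span]
    using span_proj_props[of w n x] by (intro orth_proj_eqI[OF subspace_span, symmetric]) auto
  then show ?thesis by (simp add: matrix_eq)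
qed

lemma span_proj_measurable:
  fixes f :: "nat \<Rightarrow> 'm \<Rightarrow> real^'d"
  assumes "\<And>i. i < n \<Longrightarrow> f i \<in> borel_measurable N"
  shows "(\<lambda>x. span_proj (\<lambda>i. f i x) n) \<in> borel_measurable N"
  using assms
proof (induction n)
  case 0
  then show ?case by simp
next
  case (Suc n)
  let ?P = "\<lambda>x. span_proj (\<lambda>i. f i x) n"
  have P: "?P \<in> borel_measurable N" using Suc by simp
  have f: "f n \<in> borel_measurable N" using Suc by simp
  have [measurable]: "(\<lambda>x. f n x - ?P x *v f n x) \<in> borel_measurable N"
    by (intro borel_measurable_diff measurable_matrix_vector_mult P f)
  have e: "(\<lambda>x. sgn (f n x - ?P x *v f n x)) \<in> borel_measurable N"
    unfolding sgn_div_norm by measurable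
  have "continuous_on UNIV (\<lambda>e::real^'d. \<chi> i j. e $ i * e $ j)"
    by (intro continuous_intros)
  from borel_measurable_continuous_on[OF this e]
  have "(\<lambda>x. \<chi> i j. sgn (f n x - ?P x *v f n x) $ i * sgn (f n x - ?P x *v f n x) $ j) \<in> borel_measurable N" .
  then show ?case
    using P by (simp add: Let_def)
qed

text \<open>The edge vectors at the vertex \<open>x 0\<close>; their span is the direction of the simplex.\<close>

definition edges :: "(nat \<Rightarrow> 'a::ab_group_add) \<Rightarrow> nat \<Rightarrow> 'a" where
  "edges x i = x (Suc i) - x 0"

lemma edges_measurable:
  assumes "i < k"
  shows "(\<lambda>x. edges x i) \<in> borel_measurable (tuple_space k :: (nat \<Rightarrow> real^'d) measure)"
  unfolding edges_def using assms
  by (intro borel_measurable_diff measurable_component_singleton) auto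

lemma span_proj_cong:
  assumes "\<And>i. i < n \<Longrightarrow> w i = w' i"
  shows "span_proj w n = span_proj w' n"
proof -
  have "w ` {..<n} = w' ` {..<n}" using assms by (intro image_cong) auto
  then show ?thesis by (simp add: span_proj_eq)
qed

text \<open>The pointwise form of the result: the factor is that of the direction of \<open>w\<close>. If \<open>w\<close> is linearly dependent, so is
its image, and both sides are \<open>0\<close> whatever the value of \<open>proj_scale\<close>.\<close>

lemma gram_vol_mult:
  fixes A :: "real^'d^'d" and w :: "nat \<Rightarrow> real^'d"
  assumes k: "k \<le> CARD('d)"
  shows "gram_vol k (\<lambda>i. A *v w i) = proj_scale k A (span_proj w k) * gram_vol k w"
proof (cases "dim (span (w ` {..<k})) = k")
  case True
  obtain b where b: "orthonormal_frame k b" "span (b ` {..<k}) = span (w ` {..<k})"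
    using subspace_frame[OF subspace_span[of "w ` {..<k}"]] unfolding True by blast
  have "gram_vol k (\<lambda>i. A *v w i) = gram_vol k (\<lambda>i. A *v b i) * gram_vol k w"
    by (rule gram_vol_linear[OF k matrix_vector_mul_linear b(1)]) (simp add: b(2) span_base)
  also have "gram_vol k (\<lambda>i. A *v b i) = proj_scale k A (span_proj w k)"
    using proj_scale_eq[OF b(1) k, of A] by (simp add: span_proj_eq b(2))
  finally show ?thesis .
next
  case False
  have "dim (span (w ` {..<k})) \<le> k"
    using dim_le_card'[of "w ` {..<k}"] card_image_le[of "{..<k}" w] by (simp add: dim_span)
  with False have less: "dim (span (w ` {..<k})) < k" by simp
  have "dim (span ((\<lambda>i. A *v w i) ` {..<k})) = dim ((*v) A ` span (w ` {..<k}))"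
    using span_linear_image[OF matrix_vector_mul_linear[of A], of "w ` {..<k}"]
    by (simp add: image_comp o_def)
  also have "\<dots> \<le> dim (span (w ` {..<k}))"
    by (rule dim_image_le[OF matrix_vector_mul_linear])
  finally have "dim (span ((\<lambda>i. A *v w i) ` {..<k})) < k" using less by simp
  then show ?thesis
    using gram_vol_degenerate[OF k] less by simp
qed

section \<open>Uniqueness of homogeneous measures\<close>

text \<open>An isometry pulls the ball around \<open>T x\<close> back to the ball around \<open>x\<close>.\<close>

lemma isometric_emeasure_ball:
  fixes T :: "'a::{metric_space, second_countable_topology} \<Rightarrow> 'a"
  assumes sets: "sets \<mu> = sets borel" and iso: "\<And>x y. dist (T x) (T y) = dist x y"
    and inv: "distr \<mu> borel T = \<mu>"
  shows "emeasure \<mu> (ball (T x) r) = emeasure \<mu> (ball x r)"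
proof -
  have "continuous_on UNIV T"
    unfolding continuous_on_iff using iso by auto
  then have "T \<in> borel_measurable borel" by (rule borel_measurable_continuous_onI)
  then have T: "T \<in> \<mu> \<rightarrow>\<^sub>M borel" using sets by (simp cong: measurable_cong_sets)
  have "emeasure \<mu> (ball (T x) r) = emeasure (distr \<mu> borel T) (ball (T x) r)" by (simp add: inv)
  also have "\<dots> = emeasure \<mu> (T -` ball (T x) r \<inter> space \<mu>)"
    by (rule emeasure_distr[OF T]) simp
  also have "T -` ball (T x) r \<inter> space \<mu> = ball x r"
    using sets_eq_imp_space_eq[OF sets] iso by auto
  finally show ?thesis .
qed

text \<open>If one ball of radius \<open>r\<close> were null, all of them would be, and countably many of them cover \<open>S\<close> by Lindelof's theorem.\<close>

lemma homogeneous_ball_pos: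
  fixes \<nu> :: "'a::{metric_space, second_countable_topology} measure"
  assumes sets: "sets \<nu> = sets borel" and supp: "AE x in \<nu>. x \<in> S"
    and pos: "emeasure \<nu> UNIV \<noteq> 0"
    and hom: "\<And>x y. x \<in> S \<Longrightarrow> y \<in> S \<Longrightarrow> emeasure \<nu> (ball x r) = emeasure \<nu> (ball y r)"
    and x: "x \<in> S" and r: "0 < r"
  shows "0 < emeasure \<nu> (ball x r)"
proof (rule ccontr)
  assume "\<not> 0 < emeasure \<nu> (ball x r)"
  then have null: "ball y r \<in> null_sets \<nu>" if "y \<in> S" for y
    using hom[OF x that] sets by (auto simp: null_sets_def)
  obtain F where F: "F \<subseteq> (\<lambda>y. ball y r) ` S" "countable F" "\<Union>F = (\<Union>y\<in>S. ball y r)"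
    using Lindelof[of "(\<lambda>y. ball y r) ` S"] by auto
  have "\<Union>F \<in> null_sets \<nu>"
    using null F by (intro null_sets_UN'[of F "\<lambda>x. x", simplified]) auto
  then have notin: "AE y in \<nu>. y \<notin> \<Union>F" by (rule AE_not_in)
  have "S \<subseteq> \<Union>F"
  proof
    fix y assume y: "y \<in> S"
    have "y \<in> ball y r" using r by (simp only: centre_in_ball)
    then have "y \<in> (\<Union>y\<in>S. ball y r)" using y by (rule UN_I[rotated])
    then show "y \<in> \<Union>F" by (simp only: F(3))
  qed
  have "AE y in \<nu>. False"
    by (rule AE_mp[OF notin], rule AE_mp[OF supp], rule AE_I2) (use \<open>S \<subseteq> \<Union>F\<close> in blast)
  then show False
    using pos sets_eq_imp_space_eq[OF sets] emeasure_eq_0_AE[of "\<lambda>_. True" \<nu>] by simp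
qed

text \<open>Let \<open>m r\<close> and \<open>n r\<close> be the masses that \<open>\<mu>\<close> and \<open>\<nu>\<close> give to a ball of radius \<open>r\<close> centred in \<open>S\<close>. Integrating the
kernel \<open>dist x y < r\<close> in two orders gives \<open>n r * \<mu> UNIV = m r * \<nu> UNIV\<close>. If the \<open>r\<close>-neighbourhood of \<open>C\<close> lies in
\<open>U\<close>, the same computation restricted to \<open>x \<in> C\<close> and \<open>y \<in> U\<close> gives \<open>n r * \<mu> C \<le> m r * \<nu> U\<close>. Together,
\<open>\<mu> C * \<nu> UNIV \<le> \<nu> U * \<mu> UNIV\<close>, and \<open>U\<close> may shrink to the closed set \<open>C\<close>.\<close>

lemma homogeneous_measures_le:
  fixes \<mu> \<nu> :: "'a::{metric_space, second_countable_topology} measure"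
  assumes \<mu>: "finite_measure \<mu>" "sets \<mu> = sets borel" "AE x in \<mu>. x \<in> S"
    and \<nu>: "finite_measure \<nu>" "sets \<nu> = sets borel" "AE x in \<nu>. x \<in> S"
    and hom_\<mu>: "\<And>x y r. x \<in> S \<Longrightarrow> y \<in> S \<Longrightarrow> emeasure \<mu> (ball x r) = emeasure \<mu> (ball y r)"
    and hom_\<nu>: "\<And>x y r. x \<in> S \<Longrightarrow> y \<in> S \<Longrightarrow> emeasure \<nu> (ball x r) = emeasure \<nu> (ball y r)"
    and C: "closed C"
  shows "emeasure \<mu> C * emeasure \<nu> UNIV \<le> emeasure \<nu> C * emeasure \<mu> UNIV"
proof (cases "emeasure \<nu> UNIV = 0 \<or> S = {}")
  case True
  then consider "emeasure \<nu> UNIV = 0" | "S = {}" by blast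
  then show ?thesis
  proof cases
    case 2
    then have "AE x in \<mu>. False" using \<mu>(3) by simp
    then have "emeasure \<mu> (space \<mu>) = 0"
      using emeasure_eq_0_AE[of "\<lambda>_. True" \<mu>] by simp
    then have "emeasure \<mu> C = 0"
      by (metis emeasure_space le_zero_eq)
    then show ?thesis by simp
  qed simp
next
  case False
  then obtain x0 where x0: "x0 \<in> S" and pos: "emeasure \<nu> UNIV \<noteq> 0" by auto
  interpret \<mu>: finite_measure \<mu> by fact
  interpret \<nu>: finite_measure \<nu> by fact
  interpret pair_sigma_finite \<mu> \<nu> ..
  have space: "space \<mu> = UNIV" "space \<nu> = UNIV"
    using \<mu>(2) \<nu>(2) by (auto dest: sets_eq_imp_space_eq)
  have [measurable_cong]: "sets \<mu> = sets borel" "sets \<nu> = sets borel" using \<mu>(2) \<nu>(2) .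
  \<comment> \<open>Fubini for the kernel, which is symmetric in \<open>x\<close> and \<open>y\<close>.\<close>
  have swap: "(\<integral>\<^sup>+x. indicator C' x * emeasure \<nu> (ball x r \<inter> U) \<partial>\<mu>)
      = (\<integral>\<^sup>+y. indicator U y * emeasure \<mu> (ball y r \<inter> C') \<partial>\<nu>)"
    if [measurable]: "C' \<in> sets borel" "U \<in> sets borel" for C' U r
  proof -
    have [measurable]: "(\<lambda>(x, y). indicator C' x * (indicator U y * indicator {z. dist x z < r} y) :: ennreal)
        \<in> borel_measurable (\<mu> \<Otimes>\<^sub>M \<nu>)"
      unfolding indicator_def by measurable
    have "(\<integral>\<^sup>+x. indicator C' x * emeasure \<nu> (ball x r \<inter> U) \<partial>\<mu>)
        = (\<integral>\<^sup>+x. \<integral>\<^sup>+y. indicator C' x * (indicator U y * indicator {z. dist x z < r} y) \<partial>\<nu> \<partial>\<mu>)"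
    proof (rule nn_integral_cong)
      fix x
      have "indicator C' x * emeasure \<nu> (ball x r \<inter> U) = indicator C' x * (\<integral>\<^sup>+y. indicator (ball x r \<inter> U) y \<partial>\<nu>)"
        by simp
      also have "\<dots> = (\<integral>\<^sup>+y. indicator C' x * indicator (ball x r \<inter> U) y \<partial>\<nu>)"
        by (rule nn_integral_cmult[symmetric], rule borel_measurable_indicator) (simp add: \<nu>(2))
      also have "\<dots> = (\<integral>\<^sup>+y. indicator C' x * (indicator U y * indicator {z. dist x z < r} y) \<partial>\<nu>)"
        by (intro nn_integral_cong) (auto simp: indicator_def)
      finally show "indicator C' x * emeasure \<nu> (ball x r \<inter> U) = \<dots>" .
    qed
    also have "\<dots> = (\<integral>\<^sup>+y. \<integral>\<^sup>+x. indicator C' x * (indicator U y * indicator {z. dist x z < r} y) \<partial>\<mu> \<partial>\<nu>)"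
      by (rule Fubini'[symmetric]) measurable
    also have "\<dots> = (\<integral>\<^sup>+y. indicator U y * emeasure \<mu> (ball y r \<inter> C') \<partial>\<nu>)"
    proof (rule nn_integral_cong)
      fix y
      have "(\<integral>\<^sup>+x. indicator C' x * (indicator U y * indicator {z. dist x z < r} y) \<partial>\<mu>)
          = (\<integral>\<^sup>+x. indicator U y * indicator (ball y r \<inter> C') x \<partial>\<mu>)"
        by (intro nn_integral_cong) (auto simp: indicator_def dist_commute)
      also have "\<dots> = indicator U y * (\<integral>\<^sup>+x. indicator (ball y r \<inter> C') x \<partial>\<mu>)"
        by (rule nn_integral_cmult, rule borel_measurable_indicator) (simp add: \<mu>(2))
      finally show "(\<integral>\<^sup>+x. indicator C' x * (indicator U y * indicator {z. dist x z < r} y) \<partial>\<mu>)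
          = indicator U y * emeasure \<mu> (ball y r \<inter> C')" by simp
    qed
    finally show ?thesis .
  qed
  have \<nu>_const: "AE x in \<mu>. emeasure \<nu> (ball x r) = emeasure \<nu> (ball x0 r)" for r
    using \<mu>(3) by eventually_elim (use hom_\<nu> x0 in blast)
  have \<mu>_const: "AE y in \<nu>. emeasure \<mu> (ball y r) = emeasure \<mu> (ball x0 r)" for r
    using \<nu>(3) by eventually_elim (use hom_\<mu> x0 in blast)
  have total: "emeasure \<nu> (ball x0 r) * emeasure \<mu> UNIV = emeasure \<mu> (ball x0 r) * emeasure \<nu> UNIV" for r
  proof -
    have "emeasure \<nu> (ball x0 r) * emeasure \<mu> UNIV = (\<integral>\<^sup>+x. emeasure \<nu> (ball x r) \<partial>\<mu>)"
      by (subst nn_integral_cong_AE[OF \<nu>_const]) (simp add: space)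
    also have "\<dots> = (\<integral>\<^sup>+y. emeasure \<mu> (ball y r) \<partial>\<nu>)"
      using swap[of UNIV UNIV r] by simp
    also have "\<dots> = emeasure \<mu> (ball x0 r) * emeasure \<nu> UNIV"
      by (subst nn_integral_cong_AE[OF \<mu>_const]) (simp add: space)
    finally show ?thesis .
  qed
  \<comment> \<open>Open neighbourhoods that shrink to \<open>C\<close>; \<open>U n\<close> contains all balls of radius \<open>1 / Suc n\<close> around \<open>C\<close>.\<close>
  define U where "U n = {x. infdist x C < inverse (real (Suc n))}" for n
  have U_open: "open (U n)" for n
    unfolding U_def by (intro open_Collect_less continuous_intros)
  have step: "emeasure \<mu> C * emeasure \<nu> UNIV \<le> emeasure \<nu> (U n) * emeasure \<mu> UNIV" if "C \<noteq> {}" for n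
  proof -
    define r where "r = inverse (real (Suc n))"
    have r: "0 < r" by (simp add: r_def)
    have sub: "ball x r \<subseteq> U n" if "x \<in> C" for x
    proof
      fix y assume "y \<in> ball x r"
      then have "dist y x < r" by (simp add: dist_commute)
      with infdist_le[OF that, of y] show "y \<in> U n" by (simp add: U_def r_def)
    qed
    have [measurable]: "C \<in> sets borel" "U n \<in> sets borel"
      using C U_open by auto
    have "emeasure \<nu> (ball x0 r) * emeasure \<mu> C = (\<integral>\<^sup>+x. emeasure \<nu> (ball x0 r) * indicator C x \<partial>\<mu>)"
      by (simp add: nn_integral_cmult_indicator)
    also have "\<dots> = (\<integral>\<^sup>+x. indicator C x * emeasure \<nu> (ball x r \<inter> U n) \<partial>\<mu>)"
    proof (rule nn_integral_cong_AE)
      show "AE x in \<mu>. emeasure \<nu> (ball x0 r) * indicator C x = indicator C x * emeasure \<nu> (ball x r \<inter> U n)"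
        using \<nu>_const[of r] by eventually_elim
          (auto simp: indicator_def Int_absorb2 dest!: sub)
    qed
    also have "\<dots> = (\<integral>\<^sup>+y. indicator (U n) y * emeasure \<mu> (ball y r \<inter> C) \<partial>\<nu>)"
      by (rule swap) auto
    also have "\<dots> \<le> (\<integral>\<^sup>+y. emeasure \<mu> (ball x0 r) * indicator (U n) y \<partial>\<nu>)"
    proof (rule nn_integral_mono_AE)
      show "AE y in \<nu>. indicator (U n) y * emeasure \<mu> (ball y r \<inter> C)
          \<le> emeasure \<mu> (ball x0 r) * indicator (U n) y"
        using \<mu>_const[of r]
      proof eventually_elim
        case (elim y)
        have "emeasure \<mu> (ball y r \<inter> C) \<le> emeasure \<mu> (ball y r)"
          by (rule emeasure_mono) (auto simp: \<mu>(2))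
        then show ?case unfolding elim by (auto simp: indicator_def)
      qed
    qed
    also have "\<dots> = emeasure \<mu> (ball x0 r) * emeasure \<nu> (U n)"
      by (simp add: nn_integral_cmult_indicator)
    finally have le: "emeasure \<nu> (ball x0 r) * emeasure \<mu> C \<le> emeasure \<mu> (ball x0 r) * emeasure \<nu> (U n)" .
    have "emeasure \<nu> (ball x0 r) * (emeasure \<mu> C * emeasure \<nu> UNIV)
        = (emeasure \<nu> (ball x0 r) * emeasure \<mu> C) * emeasure \<nu> UNIV"
      by (simp add: mult.assoc)
    also have "\<dots> \<le> (emeasure \<mu> (ball x0 r) * emeasure \<nu> (U n)) * emeasure \<nu> UNIV"
      by (rule mult_right_mono[OF le]) simp
    also have "\<dots> = (emeasure \<mu> (ball x0 r) * emeasure \<nu> UNIV) * emeasure \<nu> (U n)"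
      by (simp add: mult_ac)
    also have "\<dots> = emeasure \<nu> (ball x0 r) * (emeasure \<nu> (U n) * emeasure \<mu> UNIV)"
      unfolding total[symmetric] by (simp add: mult_ac)
    finally have "emeasure \<nu> (ball x0 r) * (emeasure \<mu> C * emeasure \<nu> UNIV)
        \<le> emeasure \<nu> (ball x0 r) * (emeasure \<nu> (U n) * emeasure \<mu> UNIV)" .
    moreover have "0 < emeasure \<nu> (ball x0 r)"
      by (rule homogeneous_ball_pos[OF \<nu>(2,3) pos hom_\<nu> x0 r])
    moreover have "emeasure \<nu> (ball x0 r) < top"
      by (rule \<nu>.emeasure_finite[THEN top.not_eq_extremum[THEN iffD1]])
    ultimately show ?thesis
      by (simp add: ennreal_mult_le_mult_iff)
  qed
  show ?thesis
  proof (cases "C = {}")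
    case False
    have "(\<lambda>n. emeasure \<nu> (U n)) \<longlonglongrightarrow> emeasure \<nu> (\<Inter>n. U n)"
    proof (rule Lim_emeasure_decseq)
      show "decseq U"
        unfolding U_def decseq_def by (force intro: less_le_trans le_imp_inverse_le)
    qed (use U_open \<nu>(2) in auto)
    also have "(\<Inter>n. U n) = C"
    proof
      show "C \<subseteq> (\<Inter>n. U n)" by (auto simp: U_def)
      show "(\<Inter>n. U n) \<subseteq> C"
      proof
        fix x assume x: "x \<in> (\<Inter>n. U n)"
        have "infdist x C = 0"
        proof (rule ccontr)
          assume "infdist x C \<noteq> 0"
          then have "0 < infdist x C" using infdist_nonneg[of x C] by linarith
          then obtain n where "inverse (real (Suc n)) < infdist x C"
            using reals_Archimedean by blast
          moreover have "infdist x C < inverse (real (Suc n))" using x by (auto simp: U_def)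
          ultimately show False by linarith
        qed
        then show "x \<in> C" using in_closed_iff_infdist_zero[OF C False] by simp
      qed
    qed
    finally have "(\<lambda>n. emeasure \<mu> UNIV * emeasure \<nu> (U n)) \<longlonglongrightarrow> emeasure \<mu> UNIV * emeasure \<nu> C"
      by (intro ennreal_tendsto_cmult) (simp_all add: less_top[symmetric])
    then have "(\<lambda>n. emeasure \<nu> (U n) * emeasure \<mu> UNIV) \<longlonglongrightarrow> emeasure \<nu> C * emeasure \<mu> UNIV"
      by (simp add: mult.commute)
    then show ?thesis
      by (rule LIMSEQ_le_const) (use step[OF False] in blast)
  qed simp
qed

text \<open>Transitivity of the isometries on \<open>S\<close> makes both measures give equal mass to balls of equal radius. The
preceding inequality in both directions yields equality on closed sets, which generate the Borel sets.\<close>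

lemma invariant_measures_proportional:
  fixes \<mu> \<nu> :: "'a::{metric_space, second_countable_topology} measure"
  assumes \<mu>: "finite_measure \<mu>" "sets \<mu> = sets borel" "AE x in \<mu>. x \<in> S"
    and \<nu>: "prob_space \<nu>" "sets \<nu> = sets borel" "AE x in \<nu>. x \<in> S"
    and trans: "\<And>x y. x \<in> S \<Longrightarrow> y \<in> S \<Longrightarrow> \<exists>T. T x = y \<and> (\<forall>u v. dist (T u) (T v) = dist u v)
        \<and> distr \<mu> borel T = \<mu> \<and> distr \<nu> borel T = \<nu>"
    and Q: "Q \<in> sets borel"
  shows "emeasure \<mu> Q = emeasure \<mu> UNIV * emeasure \<nu> Q"
proof -
  interpret \<mu>: finite_measure \<mu> by fact
  interpret \<nu>: prob_space \<nu> by fact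
  have hom: "emeasure \<mu> (ball x r) = emeasure \<mu> (ball y r)" "emeasure \<nu> (ball x r) = emeasure \<nu> (ball y r)"
    if "x \<in> S" "y \<in> S" for x y r
    using trans[OF that] isometric_emeasure_ball[OF \<mu>(2)] isometric_emeasure_ball[OF \<nu>(2)] by metis+
  have one: "emeasure \<nu> UNIV = 1"
    using \<nu>.emeasure_space_1 sets_eq_imp_space_eq[OF \<nu>(2)] by simp
  have closed: "emeasure \<mu> C = emeasure \<mu> UNIV * emeasure \<nu> C" if "closed C" for C
    using homogeneous_measures_le[OF \<mu> \<nu>.finite_measure_axioms \<nu>(2,3) hom that]
      homogeneous_measures_le[OF \<nu>.finite_measure_axioms \<nu>(2,3) \<mu> hom(2,1) that]
    by (simp add: one mult.commute antisym)
  have "\<mu> = scale_measure (emeasure \<mu> UNIV) \<nu>"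
  proof (rule measure_eqI_generator_eq[where E = "Collect closed" and \<Omega> = UNIV and A = "\<lambda>_. UNIV"])
    show "Int_stable (Collect closed :: 'a set set)" by (auto simp: Int_stable_def)
    show "sets \<mu> = sigma_sets UNIV (Collect closed)"
      unfolding \<mu>(2) borel_eq_closed by (rule sets_measure_of) simp
    show "sets (scale_measure (emeasure \<mu> UNIV) \<nu>) = sigma_sets UNIV (Collect closed)"
      unfolding sets_scale_measure \<nu>(2) borel_eq_closed by (rule sets_measure_of) simp
    show "emeasure \<mu> C = emeasure (scale_measure (emeasure \<mu> UNIV) \<nu>) C" if "C \<in> Collect closed" for C
      using closed[of C] that unfolding emeasure_scale_measure by blast
  qed (simp_all add: \<mu>.emeasure_finite)
  from arg_cong[OF this, of "\<lambda>M. emeasure M Q"] show ?thesis by simp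
qed

section \<open>The compact orbit of projection matrices\<close>

lemma norm_mult_transpose_orthogonal:
  fixes U M :: "real^'d^'d"
  assumes "orthogonal_matrix U"
  shows "norm (M ** transpose U) = norm M"
proof -
  have row: "(M ** transpose U) $ i = U *v (M $ i)" for i
    by (simp add: vec_eq_iff matrix_matrix_mult_def matrix_vector_mult_def transpose_def mult.commute)
  have "norm ((M ** transpose U) $ i) = norm (M $ i)" for i
    unfolding row norm_eq_sqrt_inner orthogonal_matrix_inner[OF assms] ..
  then show ?thesis by (simp add: norm_vec_def)
qed

lemma norm_transpose_matrix:
  fixes M :: "real^'d^'d"
  shows "norm (transpose M) = norm M"
proof -
  have "transpose M \<bullet> transpose M = M \<bullet> M"
    unfolding inner_vec_def transpose_def by simp (rule sum.swap)
  then show ?thesis by (simp add: norm_eq_sqrt_inner)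
qed

lemma dist_conjugate:
  fixes U P Q :: "real^'d^'d"
  assumes U: "orthogonal_matrix U"
  shows "dist (U ** P ** transpose U) (U ** Q ** transpose U) = dist P Q"
proof -
  have "U ** P ** transpose U - U ** Q ** transpose U = U ** (P - Q) ** transpose U"
  proof -
    have "U ** (P - Q) = U ** P - U ** Q"
      by (simp add: vec_eq_iff matrix_matrix_mult_def right_diff_distrib sum_subtractf)
    moreover have "(M - N) ** transpose U = M ** transpose U - N ** transpose U" for M N :: "real^'d^'d"
      by (simp add: vec_eq_iff matrix_matrix_mult_def left_diff_distrib sum_subtractf)
    ultimately show ?thesis by simp
  qed
  then have "dist (U ** P ** transpose U) (U ** Q ** transpose U) = norm (U ** (P - Q))"
    by (simp add: dist_norm norm_mult_transpose_orthogonal[OF U])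
  also have "\<dots> = norm (transpose (P - Q) ** transpose U)"
    by (metis matrix_transpose_mul norm_transpose_matrix)
  also have "\<dots> = dist P Q"
    by (simp only: norm_mult_transpose_orthogonal[OF U] norm_transpose_matrix dist_norm)
  finally show ?thesis .
qed

text \<open>The Grassmannian as a set of matrices.\<close>

definition proj_matrices :: "nat \<Rightarrow> (real^'d^'d) set" where
  "proj_matrices k = proj_matrix ` {L. subspace L \<and> dim L = k}"

lemma conjugation_between_proj_matrices:
  assumes "P \<in> proj_matrices k" "Q \<in> proj_matrices k"
  obtains U where "orthogonal_matrix U" "U ** P ** transpose U = Q"
proof -
  obtain L L' where L: "subspace L" "dim L = k" "P = proj_matrix L"
    and L': "subspace L'" "dim L' = k" "Q = proj_matrix L'"
    using assms by (auto simp: proj_matrices_def)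
  obtain U where U: "orthogonal_matrix U" "(*v) U ` L = L'"
    using rotation_between_subspaces[OF L(1) L'(1)] L(2) L'(2) by auto
  then show ?thesis
    using that[OF U(1)] proj_matrix_rotate[OF U(1) L(1)] L(3) L'(3) by simp
qed

lemma compact_orthogonal_matrices: "compact {U :: real^'d^'d. orthogonal_matrix U}"
  unfolding compact_eq_bounded_closed
proof
  have "norm U \<le> real CARD('d)" if "orthogonal_matrix U" for U :: "real^'d^'d"
  proof -
    have "transpose U *v axis i 1 = U $ i" for i
      by (simp add: vec_eq_iff matrix_vector_mult_def transpose_def axis_def if_distrib cong: if_cong)
    moreover have "orthogonal_matrix (transpose U)" using that by simp
    ultimately have "U $ i \<bullet> U $ i = 1" for i
      using orthogonal_matrix_inner[of "transpose U" "axis i 1" "axis i 1"] by (simp add: inner_axis_axis)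
    then have "norm (U $ i) = 1" for i by (simp add: norm_eq_sqrt_inner)
    then show ?thesis
      using L2_set_le_sum[of UNIV "\<lambda>i. norm (U $ i)"] by (simp add: norm_vec_def)
  qed
  then show "bounded {U :: real^'d^'d. orthogonal_matrix U}"
    unfolding bounded_iff by blast
  show "closed {U :: real^'d^'d. orthogonal_matrix U}"
    unfolding orthogonal_matrix_def matrix_matrix_mult_def transpose_def
    by (intro closed_Collect_conj closed_Collect_eq continuous_intros)
qed

text \<open>The set is an orbit of the compact group of orthogonal matrices under conjugation. Closedness is what makes
``almost surely a projection matrix'' pass to the law of a random matrix.\<close>

lemma closed_proj_matrices: "closed (proj_matrices k :: (real^'d^'d) set)"
proof (cases "proj_matrices k = ({} :: (real^'d^'d) set)")
  case False
  then obtain P :: "real^'d^'d" where P: "P \<in> proj_matrices k" by blast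
  let ?O = "{U :: real^'d^'d. orthogonal_matrix U}"
  have "proj_matrices k = (\<lambda>U. U ** P ** transpose U) ` ?O"
  proof
    show "proj_matrices k \<subseteq> (\<lambda>U. U ** P ** transpose U) ` ?O"
      using conjugation_between_proj_matrices[OF P] by (metis (mono_tags, lifting) image_eqI mem_Collect_eq subsetI)
    show "(\<lambda>U. U ** P ** transpose U) ` ?O \<subseteq> proj_matrices k"
    proof
      fix Q assume "Q \<in> (\<lambda>U. U ** P ** transpose U) ` ?O"
      then obtain U where U: "orthogonal_matrix U" "Q = U ** P ** transpose U" by auto
      obtain L where L: "subspace L" "dim L = k" "P = proj_matrix L"
        using P by (auto simp: proj_matrices_def)
      have "Q = proj_matrix ((*v) U ` L)"
        using proj_matrix_rotate[OF U(1) L(1)] U(2) L(3) by simp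
      then show "Q \<in> proj_matrices k"
        using linear_subspace_image[OF matrix_vector_mul_linear L(1)] dim_rotate[OF U(1)] L(2)
        by (auto simp: proj_matrices_def)
    qed
  qed
  moreover have "compact ((\<lambda>U. U ** P ** transpose U) ` ?O)"
    by (intro compact_continuous_image compact_orthogonal_matrices)
      (auto simp: matrix_matrix_mult_def transpose_def intro!: continuous_intros)
  ultimately show ?thesis by (simp add: compact_imp_closed)
qed simp

lemma conjugation_measurable:
  "(\<lambda>P. U ** P ** transpose U) \<in> borel_measurable (borel :: (real^'d^'d) measure)"
  by (intro borel_measurable_continuous_onI)
    (auto simp: matrix_matrix_mult_def intro!: continuous_intros)

section \<open>Random directions\<close>

lemma space_grassmannian: "space (grassmannian k) = {L. subspace L \<and> dim L = k}"
  by (simp add: grassmannian_def)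

lemma proj_matrix_measurable:
  "proj_matrix \<in> grassmannian k \<rightarrow>\<^sub>M (borel :: (real^'d^'d) measure)"
  unfolding grassmannian_def proj_matrix_def[abs_def]
  by (rule measurable_vimage_algebra1) simp

text \<open>In terms of projection matrices, rotation of a subspace is conjugation, which is continuous.\<close>

lemma rotate_subspace_measurable:
  fixes U :: "real^'d^'d"
  assumes U: "orthogonal_matrix U"
  shows "(\<lambda>L. (*v) U ` L) \<in> grassmannian k \<rightarrow>\<^sub>M grassmannian k"
proof -
  have "(\<lambda>L. (*v) U ` L) \<in> grassmannian k \<rightarrow>\<^sub>M
    vimage_algebra {L. subspace L \<and> dim L = k} (\<lambda>L. matrix (orth_proj L)) (borel :: (real^'d^'d) measure)"
  proof (rule measurable_vimage_algebra2)
    show "(\<lambda>L. (*v) U ` L) \<in> space (grassmannian k) \<rightarrow> {L. subspace L \<and> dim L = k}"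
      using linear_subspace_image[OF matrix_vector_mul_linear] dim_rotate[OF U]
      by (auto simp: space_grassmannian)
    have "(\<lambda>L. U ** proj_matrix L ** transpose U) \<in> grassmannian k \<rightarrow>\<^sub>M borel"
      by (rule measurable_compose[OF proj_matrix_measurable conjugation_measurable])
    then show "(\<lambda>L. matrix (orth_proj ((*v) U ` L))) \<in> grassmannian k \<rightarrow>\<^sub>M borel"
      by (rule measurable_cong[THEN iffD1, rotated])
        (simp add: space_grassmannian flip: proj_matrix_rotate[OF U] proj_matrix_def)
  qed
  then show ?thesis by (simp add: grassmannian_def)
qed

lemma distr_proj_matrix_invariant:
  assumes \<nu>: "rotation_invariant_prob k \<nu>" and U: "orthogonal_matrix U"
  shows "distr (distr \<nu> borel proj_matrix) borel (\<lambda>P. U ** P ** transpose U) = distr \<nu> borel proj_matrix"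
proof -
  have sets: "sets \<nu> = sets (grassmannian k)" and inv: "distr \<nu> (grassmannian k) (\<lambda>L. (*v) U ` L) = \<nu>"
    using \<nu> U by (auto simp: rotation_invariant_prob_def)
  note sp = sets_eq_imp_space_eq[OF sets]
  have p: "proj_matrix \<in> \<nu> \<rightarrow>\<^sub>M borel"
    using proj_matrix_measurable measurable_cong_sets[OF sets refl] by blast
  have r: "(\<lambda>L. (*v) U ` L) \<in> \<nu> \<rightarrow>\<^sub>M grassmannian k"
    using rotate_subspace_measurable[OF U] measurable_cong_sets[OF sets refl] by blast
  have "distr (distr \<nu> borel proj_matrix) borel (\<lambda>P. U ** P ** transpose U)
      = distr \<nu> borel (\<lambda>L. U ** proj_matrix L ** transpose U)"
    by (subst distr_distr[OF conjugation_measurable p]) (simp add: o_def)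
  also have "\<dots> = distr \<nu> borel (\<lambda>L. proj_matrix ((*v) U ` L))"
    by (intro distr_cong refl) (simp add: sp space_grassmannian proj_matrix_rotate[OF U])
  also have "\<dots> = distr (distr \<nu> (grassmannian k) (\<lambda>L. (*v) U ` L)) borel proj_matrix"
    by (subst distr_distr[OF proj_matrix_measurable r]) (simp add: o_def)
  finally show ?thesis by (simp add: inv)
qed

lemma edges_rotate:
  fixes U :: "real^'d^'d"
  assumes "i < k"
  shows "edges (\<lambda>i\<in>{..k}. U *v x i) i = U *v edges x i"
  using assms by (simp add: edges_def matrix_vector_mult_diff_distrib)

lemma gram_vol_rotate:
  fixes U :: "real^'d^'d"
  assumes "orthogonal_matrix U"
  shows "gram_vol k (edges (\<lambda>i\<in>{..k}. U *v x i)) = gram_vol k (edges x)"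
  by (rule gram_vol_inner_cong) (simp add: edges_rotate orthogonal_matrix_inner[OF assms])

lemma span_proj_rotate:
  fixes U :: "real^'d^'d"
  assumes "orthogonal_matrix U"
  shows "span_proj (edges (\<lambda>i\<in>{..k}. U *v x i)) k = U ** span_proj (edges x) k ** transpose U"
proof -
  have "span_proj (edges (\<lambda>i\<in>{..k}. U *v x i)) k = span_proj (\<lambda>i. U *v edges x i) k"
    by (rule span_proj_cong) (simp add: edges_rotate)
  also have "\<dots> = proj_matrix ((*v) U ` span (edges x ` {..<k}))"
    unfolding span_proj_eq
    using span_linear_image[OF matrix_vector_mul_linear[of U], of "edges x ` {..<k}"]
    by (simp add: image_comp o_def)
  also have "\<dots> = U ** span_proj (edges x) k ** transpose U"
    by (simp add: proj_matrix_rotate[OF assms subspace_span] span_proj_eq)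
  finally show ?thesis .
qed

lemma rotate_tuple_measurable:
  fixes U :: "real^'d^'d"
  shows "(\<lambda>x. \<lambda>i\<in>{..k}. U *v x i) \<in> tuple_space k \<rightarrow>\<^sub>M tuple_space k"
proof (rule measurable_restrict)
  fix i assume "i \<in> {..k}"
  then show "(\<lambda>x. U *v x i) \<in> tuple_space k \<rightarrow>\<^sub>M borel"
    by (intro measurable_matrix_vector_mult measurable_const measurable_component_singleton) auto
qed

text \<open>The left-hand side, as a function of \<open>Q\<close>, is the law of the direction on the event that the volume lies in \<open>B\<close>.
It is invariant under conjugation because rotations of the points preserve the volume and conjugate the
projection matrix, and it is carried by projection matrices of rank \<open>k\<close> because \<open>0 \<notin> B\<close> excludes
degenerate simplices. So it is a multiple of the law of a uniformly distributed subspace, and \<open>Q = UNIV\<close>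
gives the multiple.\<close>

lemma direction_law:
  fixes D :: "(nat \<Rightarrow> real^'d) measure"
  assumes D: "finite_measure D" "sets D = sets (tuple_space k)"
    and inv: "\<And>U :: real^'d^'d. orthogonal_matrix U \<Longrightarrow>
      distr D (tuple_space k) (\<lambda>x. \<lambda>i\<in>{..k}. U *v x i) = D"
    and \<nu>: "rotation_invariant_prob k \<nu>" and k: "k \<le> CARD('d)"
    and Q: "Q \<in> sets borel" and B: "B \<in> sets borel" "0 \<notin> B"
  shows "emeasure D {x \<in> space D. span_proj (edges x) k \<in> Q \<and> gram_vol k (edges x) \<in> B}
    = emeasure D {x \<in> space D. gram_vol k (edges x) \<in> B} * emeasure (distr \<nu> borel proj_matrix) Q"
proof -
  let ?pr = "\<lambda>x :: nat \<Rightarrow> real^'d. span_proj (edges x) k"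
  let ?v = "\<lambda>x :: nat \<Rightarrow> real^'d. gram_vol k (edges x)"
  interpret D: finite_measure D by fact
  have [measurable_cong]: "sets D = sets (tuple_space k)" by fact
  have pr[measurable]: "?pr \<in> borel_measurable (tuple_space k)"
    by (rule span_proj_measurable[OF edges_measurable])
  have v[measurable]: "?v \<in> borel_measurable (tuple_space k)"
    by (rule gram_vol_measurable[OF edges_measurable])
  define E where "E = {x \<in> space D. ?v x \<in> B}"
  have E[measurable]: "E \<in> sets D" unfolding E_def using B(1) by measurable
  define \<mu> where "\<mu> = distr (density D (indicator E)) borel ?pr"
  have pr_E: "?pr \<in> density D (indicator E) \<rightarrow>\<^sub>M borel" by measurable
  have \<mu>: "emeasure \<mu> R = emeasure D {x \<in> space D. ?pr x \<in> R \<and> ?v x \<in> B}" if [measurable]: "R \<in> sets borel" for R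
  proof -
    have "emeasure \<mu> R = emeasure (density D (indicator E)) (?pr -` R \<inter> space D)"
      unfolding \<mu>_def using emeasure_distr[OF pr_E that] by simp
    also have "\<dots> = emeasure D (E \<inter> (?pr -` R \<inter> space D))"
      by (rule emeasure_restricted[OF E]) measurable
    also have "E \<inter> (?pr -` R \<inter> space D) = {x \<in> space D. ?pr x \<in> R \<and> ?v x \<in> B}"
      by (auto simp: E_def)
    finally show ?thesis .
  qed
  have \<mu>_sets: "sets \<mu> = sets borel" by (simp add: \<mu>_def)
  have \<mu>_fin: "finite_measure \<mu>"
  proof
    show "emeasure \<mu> (space \<mu>) \<noteq> \<infinity>"
      using \<mu>[of UNIV] D.emeasure_finite sets_eq_imp_space_eq[OF \<mu>_sets] by simp
  qed
  have \<mu>_supp: "AE P in \<mu>. P \<in> proj_matrices k"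
  proof -
    have "?pr x \<in> proj_matrices k" if "x \<in> E" for x
    proof -
      have "gram_vol k (edges x) \<noteq> 0" using that B(2) by (auto simp: E_def)
      then have "\<not> dim (span (edges x ` {..<k})) < k" using gram_vol_degenerate[OF k] by blast
      moreover have "dim (span (edges x ` {..<k})) \<le> k"
        using dim_le_card'[of "edges x ` {..<k}"] card_image_le[of "{..<k}" "edges x"]
        by (simp add: dim_span)
      ultimately have "dim (span (edges x ` {..<k})) = k" by simp
      then show ?thesis
        unfolding span_proj_eq proj_matrices_def by (blast intro: subspace_span)
    qed
    then have "AE x in D. 0 < (indicator E x :: ennreal) \<longrightarrow> ?pr x \<in> proj_matrices k"
      by (intro AE_I2) (auto simp: indicator_def)
    then have "AE x in density D (indicator E). ?pr x \<in> proj_matrices k"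
      by (subst AE_density) auto
    moreover have "{P \<in> space borel. P \<in> proj_matrices k} \<in> sets borel"
      using borel_closed[OF closed_proj_matrices[of k]] by simp
    ultimately show ?thesis
      unfolding \<mu>_def using AE_distr_iff[OF pr_E, of "\<lambda>P. P \<in> proj_matrices k"] by simp
  qed
  define \<nu>' where "\<nu>' = distr \<nu> borel proj_matrix"
  have sets_\<nu>: "sets \<nu> = sets (grassmannian k)" and "prob_space \<nu>"
    using \<nu> by (auto simp: rotation_invariant_prob_def)
  have p: "proj_matrix \<in> \<nu> \<rightarrow>\<^sub>M borel"
    using proj_matrix_measurable measurable_cong_sets[OF sets_\<nu> refl] by blast
  have \<nu>'_prob: "prob_space \<nu>'"
    unfolding \<nu>'_def by (rule prob_space.prob_space_distr[OF \<open>prob_space \<nu>\<close> p])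
  have \<nu>'_sets: "sets \<nu>' = sets borel" by (simp add: \<nu>'_def)
  have \<nu>'_supp: "AE P in \<nu>'. P \<in> proj_matrices k"
  proof -
    have "AE L in \<nu>. proj_matrix L \<in> proj_matrices k"
      using sets_eq_imp_space_eq[OF sets_\<nu>]
      by (intro AE_I2) (auto simp: space_grassmannian proj_matrices_def)
    moreover have "{P \<in> space borel. P \<in> proj_matrices k} \<in> sets borel"
      using borel_closed[OF closed_proj_matrices[of k]] by simp
    ultimately show ?thesis
      unfolding \<nu>'_def using AE_distr_iff[OF p, of "\<lambda>P. P \<in> proj_matrices k"] by simp
  qed
  have \<mu>_inv: "distr \<mu> borel (\<lambda>P. U ** P ** transpose U) = \<mu>" if U: "orthogonal_matrix U" for U :: "real^'d^'d"
  proof (rule measure_eqI)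
    fix R assume "R \<in> sets (distr \<mu> borel (\<lambda>P. U ** P ** transpose U))"
    then have R[measurable]: "R \<in> sets borel" by simp
    let ?T = "\<lambda>P. U ** P ** transpose U"
    let ?rot = "\<lambda>x. \<lambda>i\<in>{..k}. U *v x i"
    have [measurable]: "?T \<in> borel \<rightarrow>\<^sub>M borel" by (rule conjugation_measurable)
    have T: "?T \<in> \<mu> \<rightarrow>\<^sub>M borel"
      using conjugation_measurable measurable_cong_sets[OF \<mu>_sets refl] by blast
    have rot: "?rot \<in> D \<rightarrow>\<^sub>M tuple_space k"
      using rotate_tuple_measurable measurable_cong_sets[OF D(2) refl] by blast
    have TR: "?T -` R \<in> sets borel"
      using measurable_sets[OF conjugation_measurable R, of U] by simp
    have E': "{x \<in> space D. ?pr x \<in> R \<and> ?v x \<in> B} \<in> sets (tuple_space k)"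
      unfolding D(2)[symmetric] using B(1) by measurable
    have "emeasure (distr \<mu> borel ?T) R = emeasure \<mu> (?T -` R)"
      using emeasure_distr[OF T R] sets_eq_imp_space_eq[OF \<mu>_sets] by simp
    also have "\<dots> = emeasure D {x \<in> space D. ?T (?pr x) \<in> R \<and> ?v x \<in> B}"
      using \<mu>[OF TR] by simp
    also have "{x \<in> space D. ?T (?pr x) \<in> R \<and> ?v x \<in> B}
        = ?rot -` {x \<in> space D. ?pr x \<in> R \<and> ?v x \<in> B} \<inter> space D"
      using measurable_space[OF rot] sets_eq_imp_space_eq[OF D(2)]
      by (auto simp: span_proj_rotate[OF U] gram_vol_rotate[OF U])
    also have "emeasure D \<dots> = emeasure (distr D (tuple_space k) ?rot) {x \<in> space D. ?pr x \<in> R \<and> ?v x \<in> B}"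
      by (rule emeasure_distr[OF rot E', symmetric])
    also have "\<dots> = emeasure \<mu> R"
      using inv[OF U] \<mu>[OF R] by simp
    finally show "emeasure (distr \<mu> borel ?T) R = emeasure \<mu> R" .
  qed (simp add: \<mu>_sets)
  have "emeasure \<mu> Q = emeasure \<mu> UNIV * emeasure \<nu>' Q"
  proof (rule invariant_measures_proportional[OF \<mu>_fin \<mu>_sets \<mu>_supp \<nu>'_prob \<nu>'_sets \<nu>'_supp _ Q])
    fix P P' :: "real^'d^'d" assume "P \<in> proj_matrices k" "P' \<in> proj_matrices k"
    then obtain U where U: "orthogonal_matrix U" "U ** P ** transpose U = P'"
      using conjugation_between_proj_matrices by blast
    show "\<exists>T. T P = P' \<and> (\<forall>u v. dist (T u) (T v) = dist u v) \<and> distr \<mu> borel T = \<mu> \<and> distr \<nu>' borel T = \<nu>'"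
      using U(2) dist_conjugate[OF U(1)] \<mu>_inv[OF U(1)] distr_proj_matrix_invariant[OF \<nu> U(1)]
      unfolding \<nu>'_def by (intro exI[of _ "\<lambda>P. U ** P ** transpose U"]) auto
  qed
  then show ?thesis
    using \<mu>[OF Q] \<mu>[of UNIV] by (simp add: \<nu>'_def)
qed

text \<open>The variable \<open>q\<close> is arbitrary where \<open>v = 0\<close>, but there the product does not depend on it. Replacing \<open>q\<close> by \<open>p\<close> on this
event gives a variable \<open>r\<close> that is independent of \<open>v\<close> and distributed like \<open>p\<close>.\<close>

lemma distr_times_eq:
  fixes p q :: "'m \<Rightarrow> 'a::{second_countable_topology, t2_space}" and v :: "'m \<Rightarrow> real"
  assumes "prob_space M"
    and p: "p \<in> borel_measurable M" and q: "q \<in> borel_measurable M" and v: "v \<in> borel_measurable M"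
    and h: "h \<in> borel_measurable borel"
    and indep: "\<And>Q B. Q \<in> sets borel \<Longrightarrow> B \<in> sets borel \<Longrightarrow>
      emeasure M {\<omega> \<in> space M. p \<omega> \<in> Q \<and> v \<omega> \<in> B}
      = emeasure M {\<omega> \<in> space M. p \<omega> \<in> Q} * emeasure M {\<omega> \<in> space M. v \<omega> \<in> B}"
    and indep_q: "\<And>Q B. Q \<in> sets borel \<Longrightarrow> B \<in> sets borel \<Longrightarrow> 0 \<notin> B \<Longrightarrow>
      emeasure M {\<omega> \<in> space M. q \<omega> \<in> Q \<and> v \<omega> \<in> B}
      = emeasure M {\<omega> \<in> space M. p \<omega> \<in> Q} * emeasure M {\<omega> \<in> space M. v \<omega> \<in> B}"
  shows "distr M borel (\<lambda>\<omega>. h (q \<omega>) * v \<omega>) = distr M borel (\<lambda>\<omega>. h (p \<omega>) * v \<omega> :: real)"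
proof -
  interpret prob_space M by fact
  note [measurable] = p q v h
  \<comment> \<open>On \<open>v = 0\<close> the independence of \<open>p\<close> and \<open>v\<close> is used, elsewhere the assumption on \<open>q\<close>.\<close>
  define r where "r \<omega> = (if v \<omega> = 0 then p \<omega> else q \<omega>)" for \<omega>
  have r[measurable]: "r \<in> borel_measurable M"
    unfolding r_def by measurable
  have indep_r: "emeasure M {\<omega> \<in> space M. r \<omega> \<in> Q \<and> v \<omega> \<in> B}
      = emeasure M {\<omega> \<in> space M. p \<omega> \<in> Q} * emeasure M {\<omega> \<in> space M. v \<omega> \<in> B}"
    if [measurable]: "Q \<in> sets borel" "B \<in> sets borel" for Q B
  proof -
    have "{\<omega> \<in> space M. r \<omega> \<in> Q \<and> v \<omega> \<in> B}
        = {\<omega> \<in> space M. p \<omega> \<in> Q \<and> v \<omega> \<in> B \<inter> {0}} \<union> {\<omega> \<in> space M. q \<omega> \<in> Q \<and> v \<omega> \<in> B - {0}}"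
      by (auto simp: r_def)
    then have "emeasure M {\<omega> \<in> space M. r \<omega> \<in> Q \<and> v \<omega> \<in> B}
        = emeasure M {\<omega> \<in> space M. p \<omega> \<in> Q \<and> v \<omega> \<in> B \<inter> {0}}
          + emeasure M {\<omega> \<in> space M. q \<omega> \<in> Q \<and> v \<omega> \<in> B - {0}}"
      by (simp only:) (subst plus_emeasure[symmetric]; auto)
    also have "\<dots> = emeasure M {\<omega> \<in> space M. p \<omega> \<in> Q} *
        (emeasure M {\<omega> \<in> space M. v \<omega> \<in> B \<inter> {0}} + emeasure M {\<omega> \<in> space M. v \<omega> \<in> B - {0}})"
      by (subst indep, simp, simp, subst indep_q) (simp_all add: distrib_left)
    also have "emeasure M {\<omega> \<in> space M. v \<omega> \<in> B \<inter> {0}} + emeasure M {\<omega> \<in> space M. v \<omega> \<in> B - {0}}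
        = emeasure M ({\<omega> \<in> space M. v \<omega> \<in> B \<inter> {0}} \<union> {\<omega> \<in> space M. v \<omega> \<in> B - {0}})"
      by (rule plus_emeasure) auto
    also have "{\<omega> \<in> space M. v \<omega> \<in> B \<inter> {0}} \<union> {\<omega> \<in> space M. v \<omega> \<in> B - {0}} = {\<omega> \<in> space M. v \<omega> \<in> B}"
      by auto
    finally show ?thesis .
  qed
  have law: "distr M borel p \<Otimes>\<^sub>M distr M borel v = distr M (borel \<Otimes>\<^sub>M borel) (\<lambda>\<omega>. (s \<omega>, v \<omega>))"
    if s[measurable]: "s \<in> borel_measurable M"
      and s_indep: "\<And>Q B. Q \<in> sets borel \<Longrightarrow> B \<in> sets borel \<Longrightarrow>
      emeasure M {\<omega> \<in> space M. s \<omega> \<in> Q \<and> v \<omega> \<in> B}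
      = emeasure M {\<omega> \<in> space M. p \<omega> \<in> Q} * emeasure M {\<omega> \<in> space M. v \<omega> \<in> B}" for s
  proof (rule pair_measure_eqI)
    show "sigma_finite_measure (distr M borel p)" "sigma_finite_measure (distr M borel v)"
      using prob_space_distr[OF p] prob_space_distr[OF v] by (auto intro: prob_space_imp_sigma_finite)
    show "sets (distr M borel p \<Otimes>\<^sub>M distr M borel v) = sets (distr M (borel \<Otimes>\<^sub>M borel) (\<lambda>\<omega>. (s \<omega>, v \<omega>)))"
      by (simp cong: sets_pair_measure_cong)
    fix Q B assume "Q \<in> sets (distr M borel p)" "B \<in> sets (distr M borel v)"
    then have [measurable]: "Q \<in> sets borel" "B \<in> sets borel" by simp_all
    have "emeasure (distr M (borel \<Otimes>\<^sub>M borel) (\<lambda>\<omega>. (s \<omega>, v \<omega>))) (Q \<times> B)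
        = emeasure M {\<omega> \<in> space M. s \<omega> \<in> Q \<and> v \<omega> \<in> B}"
      by (subst emeasure_distr) (auto intro!: arg_cong[where f = "emeasure M"])
    also have "\<dots> = emeasure (distr M borel p) Q * emeasure (distr M borel v) B"
      by (simp add: s_indep emeasure_distr vimage_def Int_def conj_commute)
    finally show "emeasure (distr M borel p) Q * emeasure (distr M borel v) B
        = emeasure (distr M (borel \<Otimes>\<^sub>M borel) (\<lambda>\<omega>. (s \<omega>, v \<omega>))) (Q \<times> B)" ..
  qed
  have "distr M (borel \<Otimes>\<^sub>M borel) (\<lambda>\<omega>. (r \<omega>, v \<omega>)) = distr M (borel \<Otimes>\<^sub>M borel) (\<lambda>\<omega>. (p \<omega>, v \<omega>))"
    by (rule trans[OF law[OF r indep_r, symmetric] law[OF p indep]])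
  then have "distr (distr M (borel \<Otimes>\<^sub>M borel) (\<lambda>\<omega>. (r \<omega>, v \<omega>))) borel (\<lambda>(P, t). h P * t)
      = distr (distr M (borel \<Otimes>\<^sub>M borel) (\<lambda>\<omega>. (p \<omega>, v \<omega>))) borel (\<lambda>(P, t). h P * t)"
    by simp
  then have "distr M borel (\<lambda>\<omega>. h (r \<omega>) * v \<omega>) = distr M borel (\<lambda>\<omega>. h (p \<omega>) * v \<omega>)"
    by (simp add: distr_distr o_def)
  moreover have "h (r \<omega>) * v \<omega> = h (q \<omega>) * v \<omega>" for \<omega>
    by (simp add: r_def)
  ultimately show ?thesis by simp
qed

section \<open>The random simplex and the random projection\<close>

theorem theorem1p1:
  fixes M :: "'m measure"
    and k :: nat
    and X :: "nat \<Rightarrow> 'm \<Rightarrow> real^'d"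
    and A :: "real^'d^'d"
    and \<E> :: "(real^'d) set"
    and \<xi> :: "'m \<Rightarrow> (real^'d) set"
  assumes "prob_space M"
    and "k \<in> {1..CARD('d)}"
    and "\<And>i. i \<le> k \<Longrightarrow> X i \<in> borel_measurable M"
    and "spherically_symmetric M k X"
    and "invertible A"
    and "\<E> = {x. x \<bullet> (matrix_inv (transpose A ** A) *v x) \<le> 1}"
    and "uniform_random_subspace M k \<xi>"
    and "independent_rvs M (tuple_space k) (tuple k X) (grassmannian k) \<xi>"
  shows "eq_in_distribution M
           (\<lambda>\<omega>. flat_volume k (convex hull ((\<lambda>i. A *v X i \<omega>) ` {..k})))
           (\<lambda>\<omega>. flat_volume k (orth_proj (\<xi> \<omega>) ` \<E>) / unit_ball_vol (real k)
                * flat_volume k (convex hull ((\<lambda>i. X i \<omega>) ` {..k})))"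
proof -
  interpret prob_space M by fact
  have k: "k \<le> CARD('d)" using assms(2) by simp
  obtain s where s: "\<And>x :: nat \<Rightarrow> real^'d.
      flat_volume k (convex hull (x ` {..k})) = s * gram_vol k (\<lambda>i. x (Suc i) - x 0)"
    using flat_volume_simplex[OF k] by blast
  let ?t = "tuple k X"
  define v where "v \<omega> = gram_vol k (edges (?t \<omega>))" for \<omega>
  define q where "q \<omega> = span_proj (edges (?t \<omega>)) k" for \<omega>
  define p where "p \<omega> = proj_matrix (\<xi> \<omega>)" for \<omega>
  \<comment> \<open>The two sides are \<open>h q * v\<close> and \<open>h p * v\<close>, with \<open>q\<close> the direction of the simplex and \<open>p\<close> the random subspace.\<close>
  define h where "h P = s * proj_scale k A P" for P
  have edges: "edges (?t \<omega>) i = X (Suc i) \<omega> - X 0 \<omega>" if "i < k" for i \<omega>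
    using that by (simp add: edges_def tuple_def)
  have t: "?t \<in> M \<rightarrow>\<^sub>M tuple_space k"
    unfolding tuple_def[abs_def] by (rule measurable_restrict) (use assms(3) in auto)
  have \<xi>: "\<xi> \<in> M \<rightarrow>\<^sub>M grassmannian k" and unif: "rotation_invariant_prob k (distr M (grassmannian k) \<xi>)"
    using assms(7) by (auto simp: uniform_random_subspace_def)
  have v: "v \<in> borel_measurable M"
    unfolding v_def[abs_def]
    by (rule measurable_compose[OF t gram_vol_measurable[OF edges_measurable]])
  have q: "q \<in> borel_measurable M"
    unfolding q_def[abs_def]
    by (rule measurable_compose[OF t span_proj_measurable[OF edges_measurable]])
  have p: "p \<in> borel_measurable M"
    unfolding p_def[abs_def] by (rule measurable_compose[OF \<xi> proj_matrix_measurable])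
  have h: "h \<in> borel_measurable borel"
    unfolding h_def[abs_def] by (intro borel_measurable_times borel_measurable_const proj_scale_measurable)
  have left: "flat_volume k (convex hull ((\<lambda>i. A *v X i \<omega>) ` {..k})) = h (q \<omega>) * v \<omega>" for \<omega>
  proof -
    have "flat_volume k (convex hull ((\<lambda>i. A *v X i \<omega>) ` {..k}))
        = s * gram_vol k (\<lambda>i. A *v X (Suc i) \<omega> - A *v X 0 \<omega>)"
      by (rule s)
    also have "gram_vol k (\<lambda>i. A *v X (Suc i) \<omega> - A *v X 0 \<omega>) = gram_vol k (\<lambda>i. A *v edges (?t \<omega>) i)"
      by (rule gram_vol_inner_cong) (simp add: edges matrix_vector_mult_diff_distrib)
    also have "\<dots> = proj_scale k A (q \<omega>) * v \<omega>"
      unfolding v_def q_def by (rule gram_vol_mult[OF k])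
    finally show ?thesis by (simp add: h_def)
  qed
  have right: "flat_volume k (orth_proj (\<xi> \<omega>) ` \<E>) / unit_ball_vol (real k)
      * flat_volume k (convex hull ((\<lambda>i. X i \<omega>) ` {..k})) = h (p \<omega>) * v \<omega>" if "\<omega> \<in> space M" for \<omega>
  proof -
    have L: "subspace (\<xi> \<omega>)" "dim (\<xi> \<omega>) = k"
      using measurable_space[OF \<xi> that] by (auto simp: space_grassmannian)
    obtain b where b: "orthonormal_frame k b" "span (b ` {..<k}) = \<xi> \<omega>"
      using subspace_frame[OF L(1)] L(2) by blast
    have "flat_volume k (orth_proj (\<xi> \<omega>) ` \<E>) = unit_ball_vol (real k) * gram_vol k (\<lambda>j. A *v b j)"
      using flat_volume_projected_ellipsoid[OF k b(1), of A]
      unfolding assms(6) ellipsoid_eq_image_cball[OF assms(5)] b(2) .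
    moreover have "gram_vol k (\<lambda>j. A *v b j) = proj_scale k A (p \<omega>)"
      using proj_scale_eq[OF b(1) k, of A] by (simp add: b(2) p_def)
    moreover have "unit_ball_vol (real k) \<noteq> 0"
      using unit_ball_vol_pos[of "real k"] by linarith
    ultimately have "flat_volume k (orth_proj (\<xi> \<omega>) ` \<E>) / unit_ball_vol (real k) = proj_scale k A (p \<omega>)"
      by simp
    moreover have "flat_volume k (convex hull ((\<lambda>i. X i \<omega>) ` {..k})) = s * v \<omega>"
      unfolding s v_def by (subst gram_vol_inner_cong[of k _ "edges (?t \<omega>)"]) (simp_all add: edges)
    ultimately show ?thesis by (simp add: h_def)
  qed
  have dist: "distr M borel (\<lambda>\<omega>. h (q \<omega>) * v \<omega>) = distr M borel (\<lambda>\<omega>. h (p \<omega>) * v \<omega>)"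
  proof (rule distr_times_eq[OF assms(1) p q v h])
    fix Q :: "(real^'d^'d) set" and B :: "real set"
    assume Q[measurable]: "Q \<in> sets borel" and B[measurable]: "B \<in> sets borel"
    let ?C = "{x \<in> space (tuple_space k). gram_vol k (edges x) \<in> B}"
    let ?G = "proj_matrix -` Q \<inter> space (grassmannian k)"
    have "(\<lambda>x. gram_vol k (edges x)) -` B \<inter> space (tuple_space k) \<in> sets (tuple_space k)"
      by (rule measurable_sets[OF gram_vol_measurable[OF edges_measurable] B])
    also have "(\<lambda>x. gram_vol k (edges x)) -` B \<inter> space (tuple_space k) = ?C" by auto
    finally have C: "?C \<in> sets (tuple_space k)" .
    have G: "?G \<in> sets (grassmannian k)"
      by (rule measurable_sets[OF proj_matrix_measurable Q])
    have "indep_set {?t -` B \<inter> space M |B. B \<in> sets (tuple_space k)} {\<xi> -` C \<inter> space M |C. C \<in> sets (grassmannian k)}"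
      using assms(8) by (simp add: independent_rvs_def)
    then have "prob ((?t -` ?C \<inter> space M) \<inter> (\<xi> -` ?G \<inter> space M)) = prob (?t -` ?C \<inter> space M) * prob (\<xi> -` ?G \<inter> space M)"
      by (rule indep_setD) (use C G in blast)+
    moreover have "?t -` ?C \<inter> space M = {\<omega> \<in> space M. v \<omega> \<in> B}"
      using measurable_space[OF t] by (auto simp: v_def)
    moreover have "\<xi> -` ?G \<inter> space M = {\<omega> \<in> space M. p \<omega> \<in> Q}"
      using measurable_space[OF \<xi>] by (auto simp: p_def)
    moreover have "{\<omega> \<in> space M. v \<omega> \<in> B} \<inter> {\<omega> \<in> space M. p \<omega> \<in> Q} = {\<omega> \<in> space M. p \<omega> \<in> Q \<and> v \<omega> \<in> B}"
      by auto
    ultimately show "emeasure M {\<omega> \<in> space M. p \<omega> \<in> Q \<and> v \<omega> \<in> B}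
        = emeasure M {\<omega> \<in> space M. p \<omega> \<in> Q} * emeasure M {\<omega> \<in> space M. v \<omega> \<in> B}"
      by (simp add: emeasure_eq_measure mult.commute flip: ennreal_mult)
  next
    fix Q :: "(real^'d^'d) set" and B :: "real set"
    assume Q[measurable]: "Q \<in> sets borel" and B[measurable]: "B \<in> sets borel" and "0 \<notin> B"
    let ?D = "distr M (tuple_space k) ?t"
    have pr[measurable]: "(\<lambda>x. span_proj (edges x) k) \<in> borel_measurable (tuple_space k :: (nat \<Rightarrow> real^'d) measure)"
      by (rule span_proj_measurable[OF edges_measurable])
    have vol[measurable]: "(\<lambda>x. gram_vol k (edges x)) \<in> borel_measurable (tuple_space k :: (nat \<Rightarrow> real^'d) measure)"
      by (rule gram_vol_measurable[OF edges_measurable])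
    have D: "prob_space ?D" by (rule prob_space_distr[OF t])
    have inv: "distr ?D (tuple_space k) (\<lambda>x. \<lambda>i\<in>{..k}. U *v x i) = ?D"
      if "orthogonal_matrix U" for U :: "real^'d^'d"
    proof -
      have "(\<lambda>i\<in>{..k}. U *v ?t \<omega> i) = tuple k (\<lambda>i \<omega>. U *v X i \<omega>) \<omega>" for \<omega>
        unfolding tuple_def by (intro restrict_ext) simp
      then have "distr ?D (tuple_space k) (\<lambda>x. \<lambda>i\<in>{..k}. U *v x i) = distr M (tuple_space k) (tuple k (\<lambda>i \<omega>. U *v X i \<omega>))"
        by (subst distr_distr[OF rotate_tuple_measurable t]) (simp add: o_def)
      also have "\<dots> = ?D" using assms(4) that by (simp add: spherically_symmetric_def)
      finally show ?thesis .
    qed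
    have "emeasure ?D {x \<in> space ?D. span_proj (edges x) k \<in> Q \<and> gram_vol k (edges x) \<in> B}
        = emeasure ?D {x \<in> space ?D. gram_vol k (edges x) \<in> B}
          * emeasure (distr (distr M (grassmannian k) \<xi>) borel proj_matrix) Q"
      by (rule direction_law[OF prob_space.finite_measure[OF D] _ inv unif k Q B \<open>0 \<notin> B\<close>]) simp_all
    moreover have "emeasure ?D {x \<in> space ?D. span_proj (edges x) k \<in> Q \<and> gram_vol k (edges x) \<in> B}
        = emeasure M {\<omega> \<in> space M. q \<omega> \<in> Q \<and> v \<omega> \<in> B}"
      using measurable_space[OF t]
      by (subst emeasure_distr[OF t]) (auto simp: q_def v_def intro!: arg_cong[where f = "emeasure M"])
    moreover have "emeasure ?D {x \<in> space ?D. gram_vol k (edges x) \<in> B} = emeasure M {\<omega> \<in> space M. v \<omega> \<in> B}"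
      using measurable_space[OF t]
      by (subst emeasure_distr[OF t]) (auto simp: v_def intro!: arg_cong[where f = "emeasure M"])
    moreover have "emeasure (distr (distr M (grassmannian k) \<xi>) borel proj_matrix) Q = emeasure M {\<omega> \<in> space M. p \<omega> \<in> Q}"
      unfolding distr_distr[OF proj_matrix_measurable \<xi>]
      using emeasure_distr[OF measurable_comp[OF \<xi> proj_matrix_measurable] Q]
      by (simp add: p_def o_def vimage_def Int_def conj_commute)
    ultimately show "emeasure M {\<omega> \<in> space M. q \<omega> \<in> Q \<and> v \<omega> \<in> B}
        = emeasure M {\<omega> \<in> space M. p \<omega> \<in> Q} * emeasure M {\<omega> \<in> space M. v \<omega> \<in> B}"
      by (simp add: mult.commute)
  qed
  let ?Z = "\<lambda>\<omega>. flat_volume k (orth_proj (\<xi> \<omega>) ` \<E>) / unit_ball_vol (real k)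
      * flat_volume k (convex hull ((\<lambda>i. X i \<omega>) ` {..k}))"
  have hq: "(\<lambda>\<omega>. h (q \<omega>) * v \<omega>) \<in> borel_measurable M"
    using measurable_compose[OF q h] v by simp
  have hp: "(\<lambda>\<omega>. h (p \<omega>) * v \<omega>) \<in> borel_measurable M"
    using measurable_compose[OF p h] v by simp
  have "?Z \<in> borel_measurable M"
    using hp by (rule measurable_cong[THEN iffD2, rotated]) (rule right)
  moreover have "distr M borel ?Z = distr M borel (\<lambda>\<omega>. h (p \<omega>) * v \<omega>)"
    by (intro distr_cong refl right)
  ultimately show ?thesis
    unfolding eq_in_distribution_def left using hq dist by simp
qed

end
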